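(* Let $\mathcal{L}$ be a finite FOLDS signature. If $\mathcal{S}$ is a derivable judgment of the logical type theory $LTT_{\mathcal{L}}$, then its interpretation $[\![\mathcal{S}]\!]$ is a derivable judgment of MLTT.
   Context: A FOLDS signature is an inverse category $\mathcal{L}$ (skeletal, no non-identity endomorphisms, each object the domain of finitely many arrows) with a proper order: a partial order $<$ on objects with $K_f<K$ for every non-identity $f\colon K\to K_f$, and a partial order on arrows with $f<g$ whenever $\operatorname{cod}f<\operatorname{cod}g$; $K/\!/\mathcal{L}$ is the set of non-identity arrows with domain $K$, $K_f$ the codomain of $f$, and indexed tuples are listed in increasing order. Finite means finitely many objects and arrows. Syntax $LTT_{\mathcal{L}}$: sort expressions $A(x_f)_{f\in A/\!/\mathcal{L}}$; contexts are lists $x_1:K_1,\dots,x_n:K_n$; formulas are built from $\bot,\top$ by $\wedge,\vee,\to$ and $\forall x:K$, $\exists x:K$. Judgments $\Gamma\ \mathbf{ok}$, $\Gamma\vdash K\ \mathbf{Sort}$, $\Gamma\vdash x:K$, $\Gamma\vdash\phi\ \mathbf{formula}$ are generated by: $\varnothing\ \mathbf{ok}$; context extension by a fresh variable of a well-formed sort; weakening for sorts and formulas; $\Gamma,x:K,\Delta\ \mathbf{ok}\Rightarrow\Gamma,x:K,\Delta\vdash x:K$; for each object $K$, from $\Gamma\vdash x_f:K_f(x_{pf})_{p\in K_f/\!/\mathcal{L}}$ for all $f\in K/\!/\mathcal{L}$ (just $\Gamma\ \mathbf{ok}$ if none) infer $\Gamma\vdash K(x_f)_f\ \mathbf{Sort}$;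 $\bot,\top$ are formulas in any ok context; binary connectives of formulas in $\Gamma$ are formulas in $\Gamma$; from $\Gamma\vdash K\ \mathbf{Sort}$... more precisely from $\Gamma\ \mathbf{ok}$ and $\Gamma,x:K\vdash\phi\ \mathbf{formula}$ infer $\Gamma\vdash Qx:K.\phi\ \mathbf{formula}$ for $Q\in\{\forall,\exists\}$. MLTT: intensional Martin-Löf type theory with $\Pi,\Sigma,\mathbf{1}$ (term $*$), $+$, $\mathbf{0}$ and a universe à la Tarski $\mathcal{U}$ with decoding $\mathrm{El}$. $\mathrm{Struc}(\mathcal{L}):=\Sigma(K_1:T_{K_1})\cdots(K_m:T_{K_m})$ over the objects $K_1<\dots<K_m$, where (naming type-theoretic variables by arrows of $\mathcal{L}$, equal composites naming the same variable) $T_K:=\Pi(f:\mathrm{El}(\mathrm{app}[K_f(pf)_{p\in K_f/\!/\mathcal{L}}]))_{f\in K/\!/\mathcal{L}}\ \mathcal{U}$, with $\mathrm{app}[K'(q_1,\dots,q_k)]$ the iterated application of $K'$ to $q_1,\dots,q_k$ ($\mathrm{app}( *,K')$ if $k=0$), and $T_K:=\mathbf{1}\to\mathcal{U}$ if $K/\!/\mathcal{L}=\varnothing$. Write $K^{\mathcal{M}}$ for the $K$-th projection of a variable $\mathcal{M}:\mathrm{Struc}(\mathcal{L})$. The interpretation $[\![-]\!]$: $[\![\varnothing]\!]:=(\mathcal{M}:\mathrm{Struc}(\mathcal{L}))$, $[\![\Gamma,x:K]\!]:=[\![\Gamma]\!],x:[\![K]\!]$; $[\![K(\mathbf{x})]\!]:=\mathrm{El}(\mathrm{app}[K^{\mathcal{M}}(\mathbf{x})])$;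 $[\![\bot]\!]=\mathbf{0}$, $[\![\top]\!]=\mathbf{1}$, $[\![\phi\wedge\psi]\!]=[\![\phi]\!]\times[\![\psi]\!]$, $[\![\phi\vee\psi]\!]=[\![\phi]\!]+[\![\psi]\!]$, $[\![\phi\to\psi]\!]=[\![\phi]\!]\to[\![\psi]\!]$, $[\![\exists x:K.\phi]\!]=\Sigma(x:[\![K]\!])[\![\phi]\!]$, $[\![\forall x:K.\phi]\!]=\Pi(x:[\![K]\!])[\![\phi]\!]$; variables are mapped to themselves; judgments: $\Gamma\ \mathbf{ok}\mapsto[\![\Gamma]\!]\ \mathbf{ok}$, $\Gamma\vdash K\ \mathbf{Sort}\mapsto[\![\Gamma]\!]\vdash[\![K]\!]\ \mathbf{Type}$, $\Gamma\vdash x:K\mapsto[\![\Gamma]\!]\vdash x:[\![K]\!]$, $\Gamma\vdash\phi\ \mathbf{formula}\mapsto[\![\Gamma]\!]\vdash[\![\phi]\!]\ \mathbf{Type}$. *)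

theory Defs
  imports Main
begin

section \<open>FOLDS signatures\<close>

record ('o, 'a) signature =
  Obj :: "'o set"
  Arr :: "'a set"
  Dom :: "'a \<Rightarrow> 'o"
  Cod :: "'a \<Rightarrow> 'o"
  Idn :: "'o \<Rightarrow> 'a"
  Cmp :: "'a \<Rightarrow> 'a \<Rightarrow> 'a"  \<comment> \<open>\<open>Cmp \<L> g f\<close> is \<open>g\<close> after \<open>f\<close>\<close>
  obj_less :: "'o \<Rightarrow> 'o \<Rightarrow> bool"
  arr_less :: "'a \<Rightarrow> 'a \<Rightarrow> bool"

definition is_category :: "('o, 'a) signature \<Rightarrow> bool" where
  "is_category \<L> \<longleftrightarrow>
     (\<forall>f\<in>Arr \<L>. Dom \<L> f \<in> Obj \<L> \<and> Cod \<L> f \<in> Obj \<L>) \<and>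
     (\<forall>K\<in>Obj \<L>. Idn \<L> K \<in> Arr \<L> \<and> Dom \<L> (Idn \<L> K) = K \<and> Cod \<L> (Idn \<L> K) = K) \<and>
     (\<forall>f\<in>Arr \<L>. \<forall>g\<in>Arr \<L>. Cod \<L> f = Dom \<L> g \<longrightarrow>
        Cmp \<L> g f \<in> Arr \<L> \<and> Dom \<L> (Cmp \<L> g f) = Dom \<L> f \<and> Cod \<L> (Cmp \<L> g f) = Cod \<L> g) \<and>
     (\<forall>f\<in>Arr \<L>. Cmp \<L> f (Idn \<L> (Dom \<L> f)) = f \<and> Cmp \<L> (Idn \<L> (Cod \<L> f)) f = f) \<and>
     (\<forall>f\<in>Arr \<L>. \<forall>g\<in>Arr \<L>. \<forall>h\<in>Arr \<L>. Cod \<L> f = Dom \<L> g \<longrightarrow> Cod \<L> g = Dom \<L> h \<longrightarrow>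
        Cmp \<L> h (Cmp \<L> g f) = Cmp \<L> (Cmp \<L> h g) f)"

definition is_iso :: "('o, 'a) signature \<Rightarrow> 'a \<Rightarrow> bool" where
  "is_iso \<L> f \<longleftrightarrow> f \<in> Arr \<L> \<and>
     (\<exists>g\<in>Arr \<L>. Dom \<L> g = Cod \<L> f \<and> Cod \<L> g = Dom \<L> f \<and>
        Cmp \<L> g f = Idn \<L> (Dom \<L> f) \<and> Cmp \<L> f g = Idn \<L> (Cod \<L> f))"

definition inverse_category :: "('o, 'a) signature \<Rightarrow> bool" where
  "inverse_category \<L> \<longleftrightarrow> is_category \<L> \<and>
     (\<forall>f. is_iso \<L> f \<longrightarrow> Dom \<L> f = Cod \<L> f) \<and>
     (\<forall>f\<in>Arr \<L>. Dom \<L> f = Cod \<L> f \<longrightarrow> f = Idn \<L> (Dom \<L> f)) \<and>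
     (\<forall>K\<in>Obj \<L>. finite {f \<in> Arr \<L>. Dom \<L> f = K})"

text \<open>The set \<open>K // \<L>\<close>.\<close>

definition arrows_from :: "('o, 'a) signature \<Rightarrow> 'o \<Rightarrow> 'a set" where
  "arrows_from \<L> K = {f \<in> Arr \<L>. Dom \<L> f = K \<and> f \<noteq> Idn \<L> K}"

definition strict_partial_order_on :: "'x set \<Rightarrow> ('x \<Rightarrow> 'x \<Rightarrow> bool) \<Rightarrow> bool" where
  "strict_partial_order_on X lt \<longleftrightarrow> irreflp_on X lt \<and> transp_on X lt"

definition proper_order :: "('o, 'a) signature \<Rightarrow> bool" where
  "proper_order \<L> \<longleftrightarrow>
     strict_partial_order_on (Obj \<L>) (obj_less \<L>) \<and>
     (\<forall>K\<in>Obj \<L>. \<forall>f\<in>arrows_from \<L> K. obj_less \<L> (Cod \<L> f) K) \<and>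
     strict_partial_order_on (Arr \<L>) (arr_less \<L>) \<and>
     (\<forall>f\<in>Arr \<L>. \<forall>g\<in>Arr \<L>. obj_less \<L> (Cod \<L> f) (Cod \<L> g) \<longrightarrow> arr_less \<L> f g)"

definition folds_signature :: "('o, 'a) signature \<Rightarrow> bool" where
  "folds_signature \<L> \<longleftrightarrow> inverse_category \<L> \<and> proper_order \<L>"

definition finite_signature :: "('o, 'a) signature \<Rightarrow> bool" where
  "finite_signature \<L> \<longleftrightarrow> finite (Obj \<L>) \<and> finite (Arr \<L>)"

text \<open>
  The orders are only partial, so listing a set in increasing order means listing it along some
  linear extension. Such listings \<open>os\<close> of the objects and \<open>as K\<close> of each \<open>K // \<L>\<close> are parameters
  of everything below; they are uniquely determined if the orders are total.
\<close>

definition lists_increasingly :: "('x \<Rightarrow> 'x \<Rightarrow> bool) \<Rightarrow> 'x set \<Rightarrow> 'x list \<Rightarrow> bool" where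
  "lists_increasingly lt X xs \<longleftrightarrow>
     distinct xs \<and> set xs = X \<and> sorted_wrt (\<lambda>x y. \<not> lt y x) xs"

definition increasing_listing :: "('o, 'a) signature \<Rightarrow> 'o list \<Rightarrow> ('o \<Rightarrow> 'a list) \<Rightarrow> bool" where
  "increasing_listing \<L> os as \<longleftrightarrow>
     lists_increasingly (obj_less \<L>) (Obj \<L>) os \<and>
     (\<forall>K\<in>Obj \<L>. lists_increasingly (arr_less \<L>) (arrows_from \<L> K) (as K))"


section \<open>The logical type theory of a signature\<close>

type_synonym lvar = nat

text \<open>In \<open>Sort K xs\<close> the list \<open>xs\<close> is indexed by the listing of \<open>K // \<L>\<close>.\<close>

datatype 'o sort = Sort 'o "lvar list"

datatype 'o formula =
    Bot
  | Top
  | And "'o formula" "'o formula"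
  | Or "'o formula" "'o formula"
  | Imp "'o formula" "'o formula"
  | All lvar "'o sort" "'o formula"
  | Ex lvar "'o sort" "'o formula"

type_synonym 'o lcontext = "(lvar \<times> 'o sort) list"

datatype 'o lstatement =
    LOk
  | LSort "'o sort"
  | LHasSort lvar "'o sort"
  | LFormula "'o formula"

datatype 'o ljudgment = LJudgment "'o lcontext" "'o lstatement" (infix "\<turnstile>\<^sub>L" 40)

definition vars :: "('x \<times> 'y) list \<Rightarrow> 'x set" where
  "vars \<Gamma> = fst ` set \<Gamma>"

inductive ltt_derivable :: "('o, 'a) signature \<Rightarrow> ('o \<Rightarrow> 'a list) \<Rightarrow> 'o ljudgment \<Rightarrow> bool"
  for \<L> :: "('o, 'a) signature" and as :: "'o \<Rightarrow> 'a list" where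
  l_empty:
    "ltt_derivable \<L> as ([] \<turnstile>\<^sub>L LOk)"
| l_extend:
    "\<lbrakk>ltt_derivable \<L> as (\<Gamma> \<turnstile>\<^sub>L LSort S); x \<notin> vars \<Gamma>\<rbrakk> \<Longrightarrow>
     ltt_derivable \<L> as (\<Gamma> @ [(x, S)] \<turnstile>\<^sub>L LOk)"
| l_weaken_sort:
    "\<lbrakk>ltt_derivable \<L> as (\<Gamma> @ \<Delta> \<turnstile>\<^sub>L LSort S'); ltt_derivable \<L> as (\<Gamma> @ [(x, S)] @ \<Delta> \<turnstile>\<^sub>L LOk)\<rbrakk> \<Longrightarrow>
     ltt_derivable \<L> as (\<Gamma> @ [(x, S)] @ \<Delta> \<turnstile>\<^sub>L LSort S')"
| l_weaken_formula:
    "\<lbrakk>ltt_derivable \<L> as (\<Gamma> @ \<Delta> \<turnstile>\<^sub>L LFormula \<phi>); ltt_derivable \<L> as (\<Gamma> @ [(x, S)] @ \<Delta> \<turnstile>\<^sub>L LOk)\<rbrakk> \<Longrightarrow>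
     ltt_derivable \<L> as (\<Gamma> @ [(x, S)] @ \<Delta> \<turnstile>\<^sub>L LFormula \<phi>)"
| l_var:
    "ltt_derivable \<L> as (\<Gamma> @ [(x, S)] @ \<Delta> \<turnstile>\<^sub>L LOk) \<Longrightarrow>
     ltt_derivable \<L> as (\<Gamma> @ [(x, S)] @ \<Delta> \<turnstile>\<^sub>L LHasSort x S)"
| l_sort:
    "\<lbrakk>K \<in> Obj \<L>; arrows_from \<L> K \<noteq> {};
      \<And>f. f \<in> arrows_from \<L> K \<Longrightarrow>
        ltt_derivable \<L> as
          (\<Gamma> \<turnstile>\<^sub>L LHasSort (x f) (Sort (Cod \<L> f) (map (\<lambda>p. x (Cmp \<L> p f)) (as (Cod \<L> f)))))\<rbrakk> \<Longrightarrow>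
     ltt_derivable \<L> as (\<Gamma> \<turnstile>\<^sub>L LSort (Sort K (map x (as K))))"
| l_sort_nullary:
    "\<lbrakk>K \<in> Obj \<L>; arrows_from \<L> K = {}; ltt_derivable \<L> as (\<Gamma> \<turnstile>\<^sub>L LOk)\<rbrakk> \<Longrightarrow>
     ltt_derivable \<L> as (\<Gamma> \<turnstile>\<^sub>L LSort (Sort K []))"
| l_bot:
    "ltt_derivable \<L> as (\<Gamma> \<turnstile>\<^sub>L LOk) \<Longrightarrow> ltt_derivable \<L> as (\<Gamma> \<turnstile>\<^sub>L LFormula Bot)"
| l_top:
    "ltt_derivable \<L> as (\<Gamma> \<turnstile>\<^sub>L LOk) \<Longrightarrow> ltt_derivable \<L> as (\<Gamma> \<turnstile>\<^sub>L LFormula Top)"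
| l_and:
    "\<lbrakk>ltt_derivable \<L> as (\<Gamma> \<turnstile>\<^sub>L LFormula \<phi>); ltt_derivable \<L> as (\<Gamma> \<turnstile>\<^sub>L LFormula \<psi>)\<rbrakk> \<Longrightarrow>
     ltt_derivable \<L> as (\<Gamma> \<turnstile>\<^sub>L LFormula (And \<phi> \<psi>))"
| l_or:
    "\<lbrakk>ltt_derivable \<L> as (\<Gamma> \<turnstile>\<^sub>L LFormula \<phi>); ltt_derivable \<L> as (\<Gamma> \<turnstile>\<^sub>L LFormula \<psi>)\<rbrakk> \<Longrightarrow>
     ltt_derivable \<L> as (\<Gamma> \<turnstile>\<^sub>L LFormula (Or \<phi> \<psi>))"
| l_imp:
    "\<lbrakk>ltt_derivable \<L> as (\<Gamma> \<turnstile>\<^sub>L LFormula \<phi>); ltt_derivable \<L> as (\<Gamma> \<turnstile>\<^sub>L LFormula \<psi>)\<rbrakk> \<Longrightarrow>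
     ltt_derivable \<L> as (\<Gamma> \<turnstile>\<^sub>L LFormula (Imp \<phi> \<psi>))"
| l_all:
    "\<lbrakk>ltt_derivable \<L> as (\<Gamma> \<turnstile>\<^sub>L LOk); ltt_derivable \<L> as (\<Gamma> @ [(x, S)] \<turnstile>\<^sub>L LFormula \<phi>)\<rbrakk> \<Longrightarrow>
     ltt_derivable \<L> as (\<Gamma> \<turnstile>\<^sub>L LFormula (All x S \<phi>))"
| l_ex:
    "\<lbrakk>ltt_derivable \<L> as (\<Gamma> \<turnstile>\<^sub>L LOk); ltt_derivable \<L> as (\<Gamma> @ [(x, S)] \<turnstile>\<^sub>L LFormula \<phi>)\<rbrakk> \<Longrightarrow>
     ltt_derivable \<L> as (\<Gamma> \<turnstile>\<^sub>L LFormula (Ex x S \<phi>))"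


section \<open>Martin-Loef type theory\<close>

text \<open>
  Raw expressions up to renaming of bound variables, in locally nameless form: free variables carry
  names, bound variables are de Bruijn indices. \<open>close k x t\<close> binds the free variable \<open>x\<close> of \<open>t\<close> by the
  \<open>k\<close>-th enclosing binder, and the abbreviations after \<open>subst\<close> use it to build binding expressions from
  named variables, so that the rules read as in a named presentation. Terms carry no type
  annotations.
\<close>

datatype 'n expr =
    Bound nat
  | Var 'n
  | TPi "'n expr" "'n expr"
  | TSigma "'n expr" "'n expr"
  | TPlus "'n expr" "'n expr"
  | TOne
  | TZero
  | TU
  | TEl "'n expr"
  | Lam "'n expr"
  | App "'n expr" "'n expr"
  | MkPair "'n expr" "'n expr"
  | Split "'n expr" "'n expr"
  | InL "'n expr"
  | InR "'n expr"
  | PlusE "'n expr" "'n expr" "'n expr"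
  | Star
  | OneE "'n expr" "'n expr"
  | ZeroE "'n expr"
  | CPi "'n expr" "'n expr"
  | CSigma "'n expr" "'n expr"
  | CPlus "'n expr" "'n expr"
  | COne
  | CZero

primrec close :: "nat \<Rightarrow> 'n \<Rightarrow> 'n expr \<Rightarrow> 'n expr" where
  "close k x (Bound i) = Bound i"
| "close k x (Var y) = (if y = x then Bound k else Var y)"
| "close k x (TPi A B) = TPi (close k x A) (close (Suc k) x B)"
| "close k x (TSigma A B) = TSigma (close k x A) (close (Suc k) x B)"
| "close k x (TPlus A B) = TPlus (close k x A) (close k x B)"
| "close k x TOne = TOne"
| "close k x TZero = TZero"
| "close k x TU = TU"
| "close k x (TEl a) = TEl (close k x a)"
| "close k x (Lam b) = Lam (close (Suc k) x b)"
| "close k x (App f a) = App (close k x f) (close k x a)"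
| "close k x (MkPair a b) = MkPair (close k x a) (close k x b)"
| "close k x (Split d p) = Split (close (Suc (Suc k)) x d) (close k x p)"
| "close k x (InL a) = InL (close k x a)"
| "close k x (InR b) = InR (close k x b)"
| "close k x (PlusE d e p) = PlusE (close (Suc k) x d) (close (Suc k) x e) (close k x p)"
| "close k x Star = Star"
| "close k x (OneE c p) = OneE (close k x c) (close k x p)"
| "close k x (ZeroE p) = ZeroE (close k x p)"
| "close k x (CPi a b) = CPi (close k x a) (close (Suc k) x b)"
| "close k x (CSigma a b) = CSigma (close k x a) (close (Suc k) x b)"
| "close k x (CPlus a b) = CPlus (close k x a) (close k x b)"
| "close k x COne = COne"
| "close k x CZero = CZero"

text \<open>
  Substitution for a free variable. No index is shifted because the substituted expression never
  has dangling indices in a derivation; capture is impossible.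
\<close>

primrec subst :: "'n expr \<Rightarrow> 'n expr \<Rightarrow> 'n \<Rightarrow> 'n expr" ("_\<langle>_'/_\<rangle>" [1000, 71, 0] 1000) where
  "(Bound i)\<langle>u/x\<rangle> = Bound i"
| "(Var y)\<langle>u/x\<rangle> = (if y = x then u else Var y)"
| "(TPi A B)\<langle>u/x\<rangle> = TPi (A\<langle>u/x\<rangle>) (B\<langle>u/x\<rangle>)"
| "(TSigma A B)\<langle>u/x\<rangle> = TSigma (A\<langle>u/x\<rangle>) (B\<langle>u/x\<rangle>)"
| "(TPlus A B)\<langle>u/x\<rangle> = TPlus (A\<langle>u/x\<rangle>) (B\<langle>u/x\<rangle>)"
| "TOne\<langle>u/x\<rangle> = TOne"
| "TZero\<langle>u/x\<rangle> = TZero"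
| "TU\<langle>u/x\<rangle> = TU"
| "(TEl a)\<langle>u/x\<rangle> = TEl (a\<langle>u/x\<rangle>)"
| "(Lam b)\<langle>u/x\<rangle> = Lam (b\<langle>u/x\<rangle>)"
| "(App f a)\<langle>u/x\<rangle> = App (f\<langle>u/x\<rangle>) (a\<langle>u/x\<rangle>)"
| "(MkPair a b)\<langle>u/x\<rangle> = MkPair (a\<langle>u/x\<rangle>) (b\<langle>u/x\<rangle>)"
| "(Split d p)\<langle>u/x\<rangle> = Split (d\<langle>u/x\<rangle>) (p\<langle>u/x\<rangle>)"
| "(InL a)\<langle>u/x\<rangle> = InL (a\<langle>u/x\<rangle>)"
| "(InR b)\<langle>u/x\<rangle> = InR (b\<langle>u/x\<rangle>)"
| "(PlusE d e p)\<langle>u/x\<rangle> = PlusE (d\<langle>u/x\<rangle>) (e\<langle>u/x\<rangle>) (p\<langle>u/x\<rangle>)"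
| "Star\<langle>u/x\<rangle> = Star"
| "(OneE c p)\<langle>u/x\<rangle> = OneE (c\<langle>u/x\<rangle>) (p\<langle>u/x\<rangle>)"
| "(ZeroE p)\<langle>u/x\<rangle> = ZeroE (p\<langle>u/x\<rangle>)"
| "(CPi a b)\<langle>u/x\<rangle> = CPi (a\<langle>u/x\<rangle>) (b\<langle>u/x\<rangle>)"
| "(CSigma a b)\<langle>u/x\<rangle> = CSigma (a\<langle>u/x\<rangle>) (b\<langle>u/x\<rangle>)"
| "(CPlus a b)\<langle>u/x\<rangle> = CPlus (a\<langle>u/x\<rangle>) (b\<langle>u/x\<rangle>)"
| "COne\<langle>u/x\<rangle> = COne"
| "CZero\<langle>u/x\<rangle> = CZero"

abbreviation Pi_type :: "'n \<Rightarrow> 'n expr \<Rightarrow> 'n expr \<Rightarrow> 'n expr" where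
  "Pi_type x A B \<equiv> TPi A (close 0 x B)"

abbreviation Sigma_type :: "'n \<Rightarrow> 'n expr \<Rightarrow> 'n expr \<Rightarrow> 'n expr" where
  "Sigma_type x A B \<equiv> TSigma A (close 0 x B)"

abbreviation lam :: "'n \<Rightarrow> 'n expr \<Rightarrow> 'n expr" where
  "lam x b \<equiv> Lam (close 0 x b)"

abbreviation split :: "'n \<Rightarrow> 'n \<Rightarrow> 'n expr \<Rightarrow> 'n expr \<Rightarrow> 'n expr" where
  "split x y d p \<equiv> Split (close 1 x (close 0 y d)) p"

abbreviation plusE :: "'n \<Rightarrow> 'n expr \<Rightarrow> 'n \<Rightarrow> 'n expr \<Rightarrow> 'n expr \<Rightarrow> 'n expr" where
  "plusE x d y e p \<equiv> PlusE (close 0 x d) (close 0 y e) p"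

abbreviation Pi_code :: "'n \<Rightarrow> 'n expr \<Rightarrow> 'n expr \<Rightarrow> 'n expr" where
  "Pi_code x a b \<equiv> CPi a (close 0 x b)"

abbreviation Sigma_code :: "'n \<Rightarrow> 'n expr \<Rightarrow> 'n expr \<Rightarrow> 'n expr" where
  "Sigma_code x a b \<equiv> CSigma a (close 0 x b)"

text \<open>Non-dependent versions: the bound variable does not occur in \<open>B\<close>.\<close>

abbreviation Fun_type :: "'n expr \<Rightarrow> 'n expr \<Rightarrow> 'n expr" where
  "Fun_type A B \<equiv> TPi A B"

abbreviation Prod_type :: "'n expr \<Rightarrow> 'n expr \<Rightarrow> 'n expr" where
  "Prod_type A B \<equiv> TSigma A B"

text \<open>The projections \<open>split (x,y)x p\<close> and \<open>split (x,y)y p\<close>.\<close>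

definition first :: "'n expr \<Rightarrow> 'n expr" where
  "first p = Split (Bound 1) p"

definition second :: "'n expr \<Rightarrow> 'n expr" where
  "second p = Split (Bound 0) p"

type_synonym 'n mcontext = "('n \<times> 'n expr) list"

datatype 'n mstatement =
    Ok
  | IsType "'n expr"
  | TypeEq "'n expr" "'n expr"
  | HasType "'n expr" "'n expr"
  | TermEq "'n expr" "'n expr" "'n expr"

datatype 'n mjudgment = MJudgment "'n mcontext" "'n mstatement" (infix "\<turnstile>" 40)

definition subst_context :: "'n mcontext \<Rightarrow> 'n expr \<Rightarrow> 'n \<Rightarrow> 'n mcontext" where
  "subst_context \<Delta> u x = map (\<lambda>(y, B). (y, B\<langle>u/x\<rangle>)) \<Delta>"

primrec subst_statement :: "'n mstatement \<Rightarrow> 'n expr \<Rightarrow> 'n \<Rightarrow> 'n mstatement" where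
  "subst_statement Ok u x = Ok"
| "subst_statement (IsType A) u x = IsType (A\<langle>u/x\<rangle>)"
| "subst_statement (TypeEq A B) u x = TypeEq (A\<langle>u/x\<rangle>) (B\<langle>u/x\<rangle>)"
| "subst_statement (HasType a A) u x = HasType (a\<langle>u/x\<rangle>) (A\<langle>u/x\<rangle>)"
| "subst_statement (TermEq a b A) u x = TermEq (a\<langle>u/x\<rangle>) (b\<langle>u/x\<rangle>) (A\<langle>u/x\<rangle>)"

text \<open>
  The premise on \<open>B\<close> in \<open>Pi_elim\<close> and \<open>Pi_elim_eq\<close> ensures that \<open>B\<close> has no dangling index, so that
  \<open>B\<langle>a/x\<rangle>\<close> is determined by the type of \<open>f\<close>; in the other rules this follows from the premises.
\<close>

inductive mltt_derivable :: "'n mjudgment \<Rightarrow> bool" where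
  empty: "mltt_derivable ([] \<turnstile> Ok)"
| extend:
    "\<lbrakk>mltt_derivable (\<Gamma> \<turnstile> IsType A); x \<notin> vars \<Gamma>\<rbrakk> \<Longrightarrow> mltt_derivable (\<Gamma> @ [(x, A)] \<turnstile> Ok)"
| var:
    "mltt_derivable (\<Gamma> @ [(x, A)] @ \<Delta> \<turnstile> Ok) \<Longrightarrow>
     mltt_derivable (\<Gamma> @ [(x, A)] @ \<Delta> \<turnstile> HasType (Var x) A)"
| weakening:
    "\<lbrakk>mltt_derivable (\<Gamma> @ \<Delta> \<turnstile> J); mltt_derivable (\<Gamma> \<turnstile> IsType A); x \<notin> vars (\<Gamma> @ \<Delta>)\<rbrakk> \<Longrightarrow>
     mltt_derivable (\<Gamma> @ [(x, A)] @ \<Delta> \<turnstile> J)"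
| substitution:
    "\<lbrakk>mltt_derivable (\<Gamma> @ [(x, A)] @ \<Delta> \<turnstile> J); mltt_derivable (\<Gamma> \<turnstile> HasType a A)\<rbrakk> \<Longrightarrow>
     mltt_derivable (\<Gamma> @ subst_context \<Delta> a x \<turnstile> subst_statement J a x)"
| substitution_type_eq:
    "\<lbrakk>mltt_derivable (\<Gamma> @ [(x, A)] @ \<Delta> \<turnstile> IsType B); mltt_derivable (\<Gamma> \<turnstile> TermEq a a' A)\<rbrakk> \<Longrightarrow>
     mltt_derivable (\<Gamma> @ subst_context \<Delta> a x \<turnstile> TypeEq (B\<langle>a/x\<rangle>) (B\<langle>a'/x\<rangle>))"
| substitution_term_eq:
    "\<lbrakk>mltt_derivable (\<Gamma> @ [(x, A)] @ \<Delta> \<turnstile> HasType b B); mltt_derivable (\<Gamma> \<turnstile> TermEq a a' A)\<rbrakk> \<Longrightarrow>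
     mltt_derivable (\<Gamma> @ subst_context \<Delta> a x \<turnstile> TermEq (b\<langle>a/x\<rangle>) (b\<langle>a'/x\<rangle>) (B\<langle>a/x\<rangle>))"
| type_refl: "mltt_derivable (\<Gamma> \<turnstile> IsType A) \<Longrightarrow> mltt_derivable (\<Gamma> \<turnstile> TypeEq A A)"
| type_sym: "mltt_derivable (\<Gamma> \<turnstile> TypeEq A B) \<Longrightarrow> mltt_derivable (\<Gamma> \<turnstile> TypeEq B A)"
| type_trans:
    "\<lbrakk>mltt_derivable (\<Gamma> \<turnstile> TypeEq A B); mltt_derivable (\<Gamma> \<turnstile> TypeEq B C)\<rbrakk> \<Longrightarrow>
     mltt_derivable (\<Gamma> \<turnstile> TypeEq A C)"
| term_refl: "mltt_derivable (\<Gamma> \<turnstile> HasType a A) \<Longrightarrow> mltt_derivable (\<Gamma> \<turnstile> TermEq a a A)"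
| term_sym: "mltt_derivable (\<Gamma> \<turnstile> TermEq a b A) \<Longrightarrow> mltt_derivable (\<Gamma> \<turnstile> TermEq b a A)"
| term_trans:
    "\<lbrakk>mltt_derivable (\<Gamma> \<turnstile> TermEq a b A); mltt_derivable (\<Gamma> \<turnstile> TermEq b c A)\<rbrakk> \<Longrightarrow>
     mltt_derivable (\<Gamma> \<turnstile> TermEq a c A)"
| conv:
    "\<lbrakk>mltt_derivable (\<Gamma> \<turnstile> HasType a A); mltt_derivable (\<Gamma> \<turnstile> TypeEq A B)\<rbrakk> \<Longrightarrow>
     mltt_derivable (\<Gamma> \<turnstile> HasType a B)"
| conv_eq:
    "\<lbrakk>mltt_derivable (\<Gamma> \<turnstile> TermEq a b A); mltt_derivable (\<Gamma> \<turnstile> TypeEq A B)\<rbrakk> \<Longrightarrow>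
     mltt_derivable (\<Gamma> \<turnstile> TermEq a b B)"
| Pi_form:
    "mltt_derivable (\<Gamma> @ [(x, A)] \<turnstile> IsType B) \<Longrightarrow> mltt_derivable (\<Gamma> \<turnstile> IsType (Pi_type x A B))"
| Pi_form_eq:
    "\<lbrakk>mltt_derivable (\<Gamma> \<turnstile> TypeEq A A'); mltt_derivable (\<Gamma> @ [(x, A)] \<turnstile> TypeEq B B')\<rbrakk> \<Longrightarrow>
     mltt_derivable (\<Gamma> \<turnstile> TypeEq (Pi_type x A B) (Pi_type x A' B'))"
| Pi_intro:
    "mltt_derivable (\<Gamma> @ [(x, A)] \<turnstile> HasType b B) \<Longrightarrow>
     mltt_derivable (\<Gamma> \<turnstile> HasType (lam x b) (Pi_type x A B))"
| Pi_intro_eq: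
    "mltt_derivable (\<Gamma> @ [(x, A)] \<turnstile> TermEq b b' B) \<Longrightarrow>
     mltt_derivable (\<Gamma> \<turnstile> TermEq (lam x b) (lam x b') (Pi_type x A B))"
| Pi_elim:
    "\<lbrakk>mltt_derivable (\<Gamma> @ [(x, A)] \<turnstile> IsType B);
      mltt_derivable (\<Gamma> \<turnstile> HasType f (Pi_type x A B)); mltt_derivable (\<Gamma> \<turnstile> HasType a A)\<rbrakk> \<Longrightarrow>
     mltt_derivable (\<Gamma> \<turnstile> HasType (App f a) (B\<langle>a/x\<rangle>))"
| Pi_elim_eq:
    "\<lbrakk>mltt_derivable (\<Gamma> @ [(x, A)] \<turnstile> IsType B);
      mltt_derivable (\<Gamma> \<turnstile> TermEq f f' (Pi_type x A B)); mltt_derivable (\<Gamma> \<turnstile> TermEq a a' A)\<rbrakk> \<Longrightarrow>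
     mltt_derivable (\<Gamma> \<turnstile> TermEq (App f a) (App f' a') (B\<langle>a/x\<rangle>))"
| Pi_comp:
    "\<lbrakk>mltt_derivable (\<Gamma> @ [(x, A)] \<turnstile> HasType b B); mltt_derivable (\<Gamma> \<turnstile> HasType a A)\<rbrakk> \<Longrightarrow>
     mltt_derivable (\<Gamma> \<turnstile> TermEq (App (lam x b) a) (b\<langle>a/x\<rangle>) (B\<langle>a/x\<rangle>))"
| Sigma_form:
    "mltt_derivable (\<Gamma> @ [(x, A)] \<turnstile> IsType B) \<Longrightarrow> mltt_derivable (\<Gamma> \<turnstile> IsType (Sigma_type x A B))"
| Sigma_form_eq:
    "\<lbrakk>mltt_derivable (\<Gamma> \<turnstile> TypeEq A A'); mltt_derivable (\<Gamma> @ [(x, A)] \<turnstile> TypeEq B B')\<rbrakk> \<Longrightarrow>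
     mltt_derivable (\<Gamma> \<turnstile> TypeEq (Sigma_type x A B) (Sigma_type x A' B'))"
| Sigma_intro:
    "\<lbrakk>mltt_derivable (\<Gamma> @ [(x, A)] \<turnstile> IsType B); mltt_derivable (\<Gamma> \<turnstile> HasType a A);
      mltt_derivable (\<Gamma> \<turnstile> HasType b (B\<langle>a/x\<rangle>))\<rbrakk> \<Longrightarrow>
     mltt_derivable (\<Gamma> \<turnstile> HasType (MkPair a b) (Sigma_type x A B))"
| Sigma_intro_eq:
    "\<lbrakk>mltt_derivable (\<Gamma> @ [(x, A)] \<turnstile> IsType B); mltt_derivable (\<Gamma> \<turnstile> TermEq a a' A);
      mltt_derivable (\<Gamma> \<turnstile> TermEq b b' (B\<langle>a/x\<rangle>))\<rbrakk> \<Longrightarrow>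
     mltt_derivable (\<Gamma> \<turnstile> TermEq (MkPair a b) (MkPair a' b') (Sigma_type x A B))"
| Sigma_elim:
    "\<lbrakk>mltt_derivable (\<Gamma> @ [(z, Sigma_type x A B)] \<turnstile> IsType C);
      mltt_derivable (\<Gamma> @ [(x, A), (y, B)] \<turnstile> HasType d (C\<langle>MkPair (Var x) (Var y)/z\<rangle>));
      mltt_derivable (\<Gamma> \<turnstile> HasType p (Sigma_type x A B))\<rbrakk> \<Longrightarrow>
     mltt_derivable (\<Gamma> \<turnstile> HasType (split x y d p) (C\<langle>p/z\<rangle>))"
| Sigma_elim_eq:
    "\<lbrakk>mltt_derivable (\<Gamma> @ [(z, Sigma_type x A B)] \<turnstile> IsType C);
      mltt_derivable (\<Gamma> @ [(x, A), (y, B)] \<turnstile> TermEq d d' (C\<langle>MkPair (Var x) (Var y)/z\<rangle>));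
      mltt_derivable (\<Gamma> \<turnstile> TermEq p p' (Sigma_type x A B))\<rbrakk> \<Longrightarrow>
     mltt_derivable (\<Gamma> \<turnstile> TermEq (split x y d p) (split x y d' p') (C\<langle>p/z\<rangle>))"
| Sigma_comp:
    "\<lbrakk>mltt_derivable (\<Gamma> @ [(z, Sigma_type x A B)] \<turnstile> IsType C);
      mltt_derivable (\<Gamma> @ [(x, A), (y, B)] \<turnstile> HasType d (C\<langle>MkPair (Var x) (Var y)/z\<rangle>));
      mltt_derivable (\<Gamma> \<turnstile> HasType a A); mltt_derivable (\<Gamma> \<turnstile> HasType b (B\<langle>a/x\<rangle>))\<rbrakk> \<Longrightarrow>
     mltt_derivable (\<Gamma> \<turnstile> TermEq (split x y d (MkPair a b)) (d\<langle>a/x\<rangle>\<langle>b/y\<rangle>) (C\<langle>MkPair a b/z\<rangle>))"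
| Plus_form:
    "\<lbrakk>mltt_derivable (\<Gamma> \<turnstile> IsType A); mltt_derivable (\<Gamma> \<turnstile> IsType B)\<rbrakk> \<Longrightarrow>
     mltt_derivable (\<Gamma> \<turnstile> IsType (TPlus A B))"
| Plus_form_eq:
    "\<lbrakk>mltt_derivable (\<Gamma> \<turnstile> TypeEq A A'); mltt_derivable (\<Gamma> \<turnstile> TypeEq B B')\<rbrakk> \<Longrightarrow>
     mltt_derivable (\<Gamma> \<turnstile> TypeEq (TPlus A B) (TPlus A' B'))"
| Plus_intro_left:
    "\<lbrakk>mltt_derivable (\<Gamma> \<turnstile> HasType a A); mltt_derivable (\<Gamma> \<turnstile> IsType B)\<rbrakk> \<Longrightarrow>
     mltt_derivable (\<Gamma> \<turnstile> HasType (InL a) (TPlus A B))"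
| Plus_intro_left_eq:
    "\<lbrakk>mltt_derivable (\<Gamma> \<turnstile> TermEq a a' A); mltt_derivable (\<Gamma> \<turnstile> IsType B)\<rbrakk> \<Longrightarrow>
     mltt_derivable (\<Gamma> \<turnstile> TermEq (InL a) (InL a') (TPlus A B))"
| Plus_intro_right:
    "\<lbrakk>mltt_derivable (\<Gamma> \<turnstile> IsType A); mltt_derivable (\<Gamma> \<turnstile> HasType b B)\<rbrakk> \<Longrightarrow>
     mltt_derivable (\<Gamma> \<turnstile> HasType (InR b) (TPlus A B))"
| Plus_intro_right_eq:
    "\<lbrakk>mltt_derivable (\<Gamma> \<turnstile> IsType A); mltt_derivable (\<Gamma> \<turnstile> TermEq b b' B)\<rbrakk> \<Longrightarrow>
     mltt_derivable (\<Gamma> \<turnstile> TermEq (InR b) (InR b') (TPlus A B))"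
| Plus_elim:
    "\<lbrakk>mltt_derivable (\<Gamma> @ [(z, TPlus A B)] \<turnstile> IsType C);
      mltt_derivable (\<Gamma> @ [(x, A)] \<turnstile> HasType d (C\<langle>InL (Var x)/z\<rangle>));
      mltt_derivable (\<Gamma> @ [(y, B)] \<turnstile> HasType e (C\<langle>InR (Var y)/z\<rangle>));
      mltt_derivable (\<Gamma> \<turnstile> HasType p (TPlus A B))\<rbrakk> \<Longrightarrow>
     mltt_derivable (\<Gamma> \<turnstile> HasType (plusE x d y e p) (C\<langle>p/z\<rangle>))"
| Plus_elim_eq:
    "\<lbrakk>mltt_derivable (\<Gamma> @ [(z, TPlus A B)] \<turnstile> IsType C);
      mltt_derivable (\<Gamma> @ [(x, A)] \<turnstile> TermEq d d' (C\<langle>InL (Var x)/z\<rangle>));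
      mltt_derivable (\<Gamma> @ [(y, B)] \<turnstile> TermEq e e' (C\<langle>InR (Var y)/z\<rangle>));
      mltt_derivable (\<Gamma> \<turnstile> TermEq p p' (TPlus A B))\<rbrakk> \<Longrightarrow>
     mltt_derivable (\<Gamma> \<turnstile> TermEq (plusE x d y e p) (plusE x d' y e' p') (C\<langle>p/z\<rangle>))"
| Plus_comp_left:
    "\<lbrakk>mltt_derivable (\<Gamma> @ [(z, TPlus A B)] \<turnstile> IsType C);
      mltt_derivable (\<Gamma> @ [(x, A)] \<turnstile> HasType d (C\<langle>InL (Var x)/z\<rangle>));
      mltt_derivable (\<Gamma> @ [(y, B)] \<turnstile> HasType e (C\<langle>InR (Var y)/z\<rangle>));
      mltt_derivable (\<Gamma> \<turnstile> HasType a A)\<rbrakk> \<Longrightarrow>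
     mltt_derivable (\<Gamma> \<turnstile> TermEq (plusE x d y e (InL a)) (d\<langle>a/x\<rangle>) (C\<langle>InL a/z\<rangle>))"
| Plus_comp_right:
    "\<lbrakk>mltt_derivable (\<Gamma> @ [(z, TPlus A B)] \<turnstile> IsType C);
      mltt_derivable (\<Gamma> @ [(x, A)] \<turnstile> HasType d (C\<langle>InL (Var x)/z\<rangle>));
      mltt_derivable (\<Gamma> @ [(y, B)] \<turnstile> HasType e (C\<langle>InR (Var y)/z\<rangle>));
      mltt_derivable (\<Gamma> \<turnstile> HasType b B)\<rbrakk> \<Longrightarrow>
     mltt_derivable (\<Gamma> \<turnstile> TermEq (plusE x d y e (InR b)) (e\<langle>b/y\<rangle>) (C\<langle>InR b/z\<rangle>))"
| One_form: "mltt_derivable (\<Gamma> \<turnstile> Ok) \<Longrightarrow> mltt_derivable (\<Gamma> \<turnstile> IsType TOne)"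
| One_intro: "mltt_derivable (\<Gamma> \<turnstile> Ok) \<Longrightarrow> mltt_derivable (\<Gamma> \<turnstile> HasType Star TOne)"
| One_elim:
    "\<lbrakk>mltt_derivable (\<Gamma> @ [(z, TOne)] \<turnstile> IsType C); mltt_derivable (\<Gamma> \<turnstile> HasType c (C\<langle>Star/z\<rangle>));
      mltt_derivable (\<Gamma> \<turnstile> HasType p TOne)\<rbrakk> \<Longrightarrow>
     mltt_derivable (\<Gamma> \<turnstile> HasType (OneE c p) (C\<langle>p/z\<rangle>))"
| One_elim_eq:
    "\<lbrakk>mltt_derivable (\<Gamma> @ [(z, TOne)] \<turnstile> IsType C); mltt_derivable (\<Gamma> \<turnstile> TermEq c c' (C\<langle>Star/z\<rangle>));
      mltt_derivable (\<Gamma> \<turnstile> TermEq p p' TOne)\<rbrakk> \<Longrightarrow>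
     mltt_derivable (\<Gamma> \<turnstile> TermEq (OneE c p) (OneE c' p') (C\<langle>p/z\<rangle>))"
| One_comp:
    "\<lbrakk>mltt_derivable (\<Gamma> @ [(z, TOne)] \<turnstile> IsType C); mltt_derivable (\<Gamma> \<turnstile> HasType c (C\<langle>Star/z\<rangle>))\<rbrakk> \<Longrightarrow>
     mltt_derivable (\<Gamma> \<turnstile> TermEq (OneE c Star) c (C\<langle>Star/z\<rangle>))"
| Zero_form: "mltt_derivable (\<Gamma> \<turnstile> Ok) \<Longrightarrow> mltt_derivable (\<Gamma> \<turnstile> IsType TZero)"
| Zero_elim:
    "\<lbrakk>mltt_derivable (\<Gamma> @ [(z, TZero)] \<turnstile> IsType C); mltt_derivable (\<Gamma> \<turnstile> HasType p TZero)\<rbrakk> \<Longrightarrow>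
     mltt_derivable (\<Gamma> \<turnstile> HasType (ZeroE p) (C\<langle>p/z\<rangle>))"
| Zero_elim_eq:
    "\<lbrakk>mltt_derivable (\<Gamma> @ [(z, TZero)] \<turnstile> IsType C); mltt_derivable (\<Gamma> \<turnstile> TermEq p p' TZero)\<rbrakk> \<Longrightarrow>
     mltt_derivable (\<Gamma> \<turnstile> TermEq (ZeroE p) (ZeroE p') (C\<langle>p/z\<rangle>))"
| U_form: "mltt_derivable (\<Gamma> \<turnstile> Ok) \<Longrightarrow> mltt_derivable (\<Gamma> \<turnstile> IsType TU)"
| El_form: "mltt_derivable (\<Gamma> \<turnstile> HasType a TU) \<Longrightarrow> mltt_derivable (\<Gamma> \<turnstile> IsType (TEl a))"
| El_form_eq:
    "mltt_derivable (\<Gamma> \<turnstile> TermEq a b TU) \<Longrightarrow> mltt_derivable (\<Gamma> \<turnstile> TypeEq (TEl a) (TEl b))"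
| Pi_code:
    "\<lbrakk>mltt_derivable (\<Gamma> \<turnstile> HasType a TU); mltt_derivable (\<Gamma> @ [(x, TEl a)] \<turnstile> HasType b TU)\<rbrakk> \<Longrightarrow>
     mltt_derivable (\<Gamma> \<turnstile> HasType (Pi_code x a b) TU)"
| Pi_code_eq:
    "\<lbrakk>mltt_derivable (\<Gamma> \<turnstile> TermEq a a' TU); mltt_derivable (\<Gamma> @ [(x, TEl a)] \<turnstile> TermEq b b' TU)\<rbrakk> \<Longrightarrow>
     mltt_derivable (\<Gamma> \<turnstile> TermEq (Pi_code x a b) (Pi_code x a' b') TU)"
| El_Pi:
    "\<lbrakk>mltt_derivable (\<Gamma> \<turnstile> HasType a TU); mltt_derivable (\<Gamma> @ [(x, TEl a)] \<turnstile> HasType b TU)\<rbrakk> \<Longrightarrow>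
     mltt_derivable (\<Gamma> \<turnstile> TypeEq (TEl (Pi_code x a b)) (Pi_type x (TEl a) (TEl b)))"
| Sigma_code:
    "\<lbrakk>mltt_derivable (\<Gamma> \<turnstile> HasType a TU); mltt_derivable (\<Gamma> @ [(x, TEl a)] \<turnstile> HasType b TU)\<rbrakk> \<Longrightarrow>
     mltt_derivable (\<Gamma> \<turnstile> HasType (Sigma_code x a b) TU)"
| Sigma_code_eq:
    "\<lbrakk>mltt_derivable (\<Gamma> \<turnstile> TermEq a a' TU); mltt_derivable (\<Gamma> @ [(x, TEl a)] \<turnstile> TermEq b b' TU)\<rbrakk> \<Longrightarrow>
     mltt_derivable (\<Gamma> \<turnstile> TermEq (Sigma_code x a b) (Sigma_code x a' b') TU)"
| El_Sigma:
    "\<lbrakk>mltt_derivable (\<Gamma> \<turnstile> HasType a TU); mltt_derivable (\<Gamma> @ [(x, TEl a)] \<turnstile> HasType b TU)\<rbrakk> \<Longrightarrow>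
     mltt_derivable (\<Gamma> \<turnstile> TypeEq (TEl (Sigma_code x a b)) (Sigma_type x (TEl a) (TEl b)))"
| Plus_code:
    "\<lbrakk>mltt_derivable (\<Gamma> \<turnstile> HasType a TU); mltt_derivable (\<Gamma> \<turnstile> HasType b TU)\<rbrakk> \<Longrightarrow>
     mltt_derivable (\<Gamma> \<turnstile> HasType (CPlus a b) TU)"
| Plus_code_eq:
    "\<lbrakk>mltt_derivable (\<Gamma> \<turnstile> TermEq a a' TU); mltt_derivable (\<Gamma> \<turnstile> TermEq b b' TU)\<rbrakk> \<Longrightarrow>
     mltt_derivable (\<Gamma> \<turnstile> TermEq (CPlus a b) (CPlus a' b') TU)"
| El_Plus:
    "\<lbrakk>mltt_derivable (\<Gamma> \<turnstile> HasType a TU); mltt_derivable (\<Gamma> \<turnstile> HasType b TU)\<rbrakk> \<Longrightarrow>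
     mltt_derivable (\<Gamma> \<turnstile> TypeEq (TEl (CPlus a b)) (TPlus (TEl a) (TEl b)))"
| One_code: "mltt_derivable (\<Gamma> \<turnstile> Ok) \<Longrightarrow> mltt_derivable (\<Gamma> \<turnstile> HasType COne TU)"
| El_One: "mltt_derivable (\<Gamma> \<turnstile> Ok) \<Longrightarrow> mltt_derivable (\<Gamma> \<turnstile> TypeEq (TEl COne) TOne)"
| Zero_code: "mltt_derivable (\<Gamma> \<turnstile> Ok) \<Longrightarrow> mltt_derivable (\<Gamma> \<turnstile> HasType CZero TU)"
| El_Zero: "mltt_derivable (\<Gamma> \<turnstile> Ok) \<Longrightarrow> mltt_derivable (\<Gamma> \<turnstile> TypeEq (TEl CZero) TZero)"


section \<open>The type of structures of a finite signature\<close>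

datatype ('o, 'a) name = StrName | ObjName 'o | ArrName 'a | LogName lvar

definition app :: "'n expr \<Rightarrow> 'n expr list \<Rightarrow> 'n expr" where
  "app K qs = (if qs = [] then App K Star else foldl App K qs)"

definition object_type :: "('o, 'a) signature \<Rightarrow> ('o \<Rightarrow> 'a list) \<Rightarrow> 'o \<Rightarrow> ('o, 'a) name expr" where
  "object_type \<L> as K =
     (if arrows_from \<L> K = {} then Fun_type TOne TU
      else foldr
        (\<lambda>f. Pi_type (ArrName f)
           (TEl (app (Var (ObjName (Cod \<L> f)))
                  (map (\<lambda>p. Var (ArrName (Cmp \<L> p f))) (as (Cod \<L> f))))))
        (as K) TU)"

text \<open>
  The iterated sum over \<open>K\<^sub>1, \<dots>, K\<^sub>m\<close> ends with the type of \<open>K\<^sub>m\<close>; the sum over no objects is the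
  unit type.
\<close>

fun struc_over :: "('o, 'a) signature \<Rightarrow> ('o \<Rightarrow> 'a list) \<Rightarrow> 'o list \<Rightarrow> ('o, 'a) name expr" where
  "struc_over \<L> as [] = TOne"
| "struc_over \<L> as [K] = object_type \<L> as K"
| "struc_over \<L> as (K # K' # Ks) =
     Sigma_type (ObjName K) (object_type \<L> as K) (struc_over \<L> as (K' # Ks))"

abbreviation Struc :: "('o, 'a) signature \<Rightarrow> 'o list \<Rightarrow> ('o \<Rightarrow> 'a list) \<Rightarrow> ('o, 'a) name expr" where
  "Struc \<L> os as \<equiv> struc_over \<L> as os"

text \<open>
  \<open>component os p K\<close> is the \<open>K\<close>-th projection of an element \<open>p\<close> of the iterated sum over \<open>os\<close>
  (irrelevant if \<open>K\<close> is not in \<open>os\<close>).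
\<close>

fun component :: "'o list \<Rightarrow> 'n expr \<Rightarrow> 'o \<Rightarrow> 'n expr" where
  "component [] p K = p"
| "component [K'] p K = p"
| "component (K' # K'' # Ks) p K = (if K = K' then first p else component (K'' # Ks) (second p) K)"


section \<open>The interpretation\<close>

primrec interp_sort :: "'o list \<Rightarrow> 'o sort \<Rightarrow> ('o, 'a) name expr" where
  "interp_sort os (Sort K xs) =
     TEl (app (component os (Var StrName) K) (map (\<lambda>x. Var (LogName x)) xs))"

primrec interp_formula :: "'o list \<Rightarrow> 'o formula \<Rightarrow> ('o, 'a) name expr" where
  "interp_formula os Bot = TZero"
| "interp_formula os Top = TOne"
| "interp_formula os (And \<phi> \<psi>) = Prod_type (interp_formula os \<phi>) (interp_formula os \<psi>)"
| "interp_formula os (Or \<phi> \<psi>) = TPlus (interp_formula os \<phi>) (interp_formula os \<psi>)"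
| "interp_formula os (Imp \<phi> \<psi>) = Fun_type (interp_formula os \<phi>) (interp_formula os \<psi>)"
| "interp_formula os (All x S \<phi>) =
     Pi_type (LogName x) (interp_sort os S) (interp_formula os \<phi>)"
| "interp_formula os (Ex x S \<phi>) =
     Sigma_type (LogName x) (interp_sort os S) (interp_formula os \<phi>)"

definition interp_context ::
  "('o, 'a) signature \<Rightarrow> 'o list \<Rightarrow> ('o \<Rightarrow> 'a list) \<Rightarrow> 'o lcontext \<Rightarrow> ('o, 'a) name mcontext" where
  "interp_context \<L> os as \<Gamma> =
     (StrName, Struc \<L> os as) # map (\<lambda>(x, S). (LogName x, interp_sort os S)) \<Gamma>"

primrec interp_statement :: "'o list \<Rightarrow> 'o lstatement \<Rightarrow> ('o, 'a) name mstatement" where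
  "interp_statement os LOk = Ok"
| "interp_statement os (LSort S) = IsType (interp_sort os S)"
| "interp_statement os (LHasSort x S) = HasType (Var (LogName x)) (interp_sort os S)"
| "interp_statement os (LFormula \<phi>) = IsType (interp_formula os \<phi>)"

primrec interp ::
  "('o, 'a) signature \<Rightarrow> 'o list \<Rightarrow> ('o \<Rightarrow> 'a list) \<Rightarrow> 'o ljudgment \<Rightarrow> ('o, 'a) name mjudgment" where
  "interp \<L> os as (\<Gamma> \<turnstile>\<^sub>L J) = (interp_context \<L> os as \<Gamma> \<turnstile> interp_statement os J)"

end

theory Submission
  imports Defs
begin

text \<open>
  The derivation is first interpreted over a context that declares one variable for each object of
  the signature instead of a single structure. There the sort rule amounts to applying an object
  variable of iterated product type to its arguments: the listing order guarantees that every
  composite \<open>p f\<close> occurring in the type of the \<open>f\<close>-argument is supplied before \<open>f\<close>, and associativity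
  of composition makes the instantiated types agree. Substituting the projections of
  \<open>\<M> : Struc(\<L>)\<close> for the object variables, one at a time, then gives the interpretation proper.
\<close>

section \<open>Free variables\<close>

text \<open>With projections from the start, the type of the K-th component would be known only as
  an instance of \<open>object_type\<close> at the earlier nested projections, and every step would
  have to rewrite along them. With object variables the declared types can be used verbatim; the
  nested projections are produced once, by a substitution argument about arbitrary iterated sums.
  There is a second gain. Well-formedness of the type of structures poses the same problem as the
  sort rule: forming the type of an argument f of K means applying the variable of K_f to the
  composites p f, which is the sort rule with arrow names in place of logical variables. So
  \<open>object_app_typing\<close> serves both.\<close>

primrec fv :: "'n expr \<Rightarrow> 'n set" where
  "fv (Bound i) = {}"
| "fv (Var y) = {y}"
| "fv (TPi A B) = fv A \<union> fv B"
| "fv (TSigma A B) = fv A \<union> fv B"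
| "fv (TPlus A B) = fv A \<union> fv B"
| "fv TOne = {}"
| "fv TZero = {}"
| "fv TU = {}"
| "fv (TEl a) = fv a"
| "fv (Lam b) = fv b"
| "fv (App f a) = fv f \<union> fv a"
| "fv (MkPair a b) = fv a \<union> fv b"
| "fv (Split d p) = fv d \<union> fv p"
| "fv (InL a) = fv a"
| "fv (InR b) = fv b"
| "fv (PlusE d e p) = fv d \<union> fv e \<union> fv p"
| "fv Star = {}"
| "fv (OneE c p) = fv c \<union> fv p"
| "fv (ZeroE p) = fv p"
| "fv (CPi a b) = fv a \<union> fv b"
| "fv (CSigma a b) = fv a \<union> fv b"
| "fv (CPlus a b) = fv a \<union> fv b"
| "fv COne = {}"
| "fv CZero = {}"

lemma finite_fv [simp]: "finite (fv t)"
  by (induction t) auto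

lemma close_fresh: "x \<notin> fv t \<Longrightarrow> close k x t = t"
  by (induction t arbitrary: k) auto

lemma subst_fresh: "x \<notin> fv t \<Longrightarrow> t\<langle>u/x\<rangle> = t"
  by (induction t) auto

lemma subst_close:
  "x \<noteq> z \<Longrightarrow> x \<notin> fv u \<Longrightarrow> (close k x t)\<langle>u/z\<rangle> = close k x (t\<langle>u/z\<rangle>)"
  by (induction t arbitrary: k) (auto simp: close_fresh)

lemma subst_subst_fresh: "z \<notin> fv t \<Longrightarrow> t\<langle>v/x\<rangle>\<langle>u/z\<rangle> = t\<langle>v\<langle>u/z\<rangle>/x\<rangle>"
  by (induction t) auto

lemma subst_self: "t\<langle>Var x/x\<rangle> = t"
  by (induction t) auto

lemma fv_first [simp]: "fv (first p) = fv p" and fv_second [simp]: "fv (second p) = fv p"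
  by (simp_all add: first_def second_def)

lemma subst_first [simp]: "(first p)\<langle>u/x\<rangle> = first (p\<langle>u/x\<rangle>)"
  by (simp add: first_def)

lemma subst_foldl_App: "(foldl App F qs)\<langle>u/x\<rangle> = foldl App (F\<langle>u/x\<rangle>) (map (\<lambda>q. q\<langle>u/x\<rangle>) qs)"
  by (induction qs arbitrary: F) auto

lemma subst_app: "(app F qs)\<langle>u/x\<rangle> = app (F\<langle>u/x\<rangle>) (map (\<lambda>q. q\<langle>u/x\<rangle>) qs)"
  by (simp add: app_def subst_foldl_App)


section \<open>Well-formed contexts\<close>

lemma vars_simps [simp]:
  "vars [] = {}" "vars ((x, A) # \<Gamma>) = insert x (vars \<Gamma>)" "vars (\<Gamma> @ \<Delta>) = vars \<Gamma> \<union> vars \<Delta>"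
  by (auto simp: vars_def)

lemma finite_vars [simp]: "finite (vars \<Gamma>)"
  by (simp add: vars_def)

lemma vars_subst_context [simp]: "vars (subst_context \<Delta> u x) = vars \<Delta>"
  by (force simp: vars_def subst_context_def)

lemma subst_context_simps [simp]:
  "subst_context [] u x = []"
  "subst_context ((y, B) # \<Delta>) u x = (y, B\<langle>u/x\<rangle>) # subst_context \<Delta> u x"
  "subst_context (\<Delta> @ \<Delta>') u x = subst_context \<Delta> u x @ subst_context \<Delta>' u x"
  by (auto simp: subst_context_def)

text \<open>Case analysis on a derivation of \<open>Ok\<close> does not expose the last declaration,
  since \<open>weakening\<close> and \<open>substitution\<close> also conclude \<open>Ok\<close>.
  This predicate builds contexts by extension only, so it can be inverted.\<close>

inductive wf_context :: "'n mcontext \<Rightarrow> bool" where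
  wf_nil: "wf_context []"
| wf_snoc: "\<lbrakk>wf_context \<Gamma>; mltt_derivable (\<Gamma> \<turnstile> IsType A); x \<notin> vars \<Gamma>\<rbrakk> \<Longrightarrow> wf_context (\<Gamma> @ [(x, A)])"

lemma wf_context_snoc_iff:
  "wf_context (\<Gamma> @ [(x, A)]) \<longleftrightarrow> wf_context \<Gamma> \<and> mltt_derivable (\<Gamma> \<turnstile> IsType A) \<and> x \<notin> vars \<Gamma>"
  by (auto intro: wf_snoc elim: wf_context.cases)

lemma wf_context_prefix: "wf_context (\<Gamma> @ \<Delta>) \<Longrightarrow> wf_context \<Gamma>"
proof (induction \<Delta> rule: rev_induct)
  case (snoc a \<Delta>)
  then show ?case
    by (cases a) (auto simp: wf_context_snoc_iff simp flip: append_assoc)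
qed simp

text \<open>Rule \<open>weakening\<close> inserts in the middle of a context, so each later type has
  to be weakened in turn before its declaration is added back.\<close>

lemma wf_context_insert:
  "\<lbrakk>wf_context (\<Gamma> @ \<Delta>); mltt_derivable (\<Gamma> \<turnstile> IsType A); x \<notin> vars (\<Gamma> @ \<Delta>)\<rbrakk> \<Longrightarrow>
   wf_context (\<Gamma> @ (x, A) # \<Delta>)"
proof (induction \<Delta> rule: rev_induct)
  case Nil
  then show ?case by (auto intro: wf_snoc)
next
  case (snoc a \<Delta>)
  obtain y B where [simp]: "a = (y, B)" by (cases a)
  have wf: "wf_context (\<Gamma> @ \<Delta>)" "mltt_derivable (\<Gamma> @ \<Delta> \<turnstile> IsType B)" "y \<notin> vars (\<Gamma> @ \<Delta>)"
    using snoc.prems(1) wf_context_snoc_iff[of "\<Gamma> @ \<Delta>" y B] by auto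
  have "mltt_derivable (\<Gamma> @ (x, A) # \<Delta> \<turnstile> IsType B)"
    using weakening[OF wf(2) snoc.prems(2)] snoc.prems(3) by auto
  then show ?case
    using snoc wf wf_context_snoc_iff[of "\<Gamma> @ (x, A) # \<Delta>" y B] by auto
qed

lemma wf_context_substitution:
  "\<lbrakk>wf_context (\<Gamma> @ (x, A) # \<Delta>); mltt_derivable (\<Gamma> \<turnstile> HasType a A)\<rbrakk> \<Longrightarrow>
   wf_context (\<Gamma> @ subst_context \<Delta> a x)"
proof (induction \<Delta> rule: rev_induct)
  case Nil
  then show ?case by (auto dest: wf_context_prefix)
next
  case (snoc b \<Delta>)
  obtain y B where [simp]: "b = (y, B)" by (cases b)
  have wf: "wf_context (\<Gamma> @ (x, A) # \<Delta>)" "mltt_derivable (\<Gamma> @ (x, A) # \<Delta> \<turnstile> IsType B)"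
    "y \<notin> vars (\<Gamma> @ (x, A) # \<Delta>)"
    using snoc.prems(1) wf_context_snoc_iff[of "\<Gamma> @ (x, A) # \<Delta>" y B] by auto
  have "mltt_derivable (\<Gamma> @ subst_context \<Delta> a x \<turnstile> IsType (B\<langle>a/x\<rangle>))"
    using substitution[of \<Gamma> x A \<Delta> "IsType B" a] wf snoc.prems(2) by auto
  then show ?case
    using snoc wf wf_context_snoc_iff[of "\<Gamma> @ subst_context \<Delta> a x" y "B\<langle>a/x\<rangle>"] by auto
qed

primrec context_of :: "'n mjudgment \<Rightarrow> 'n mcontext" where
  "context_of (\<Gamma> \<turnstile> J) = \<Gamma>"

text \<open>
  Well-formedness of the context is carried along instead of being derived: for the rules
  \<open>substitution_type_eq\<close> and \<open>substitution_term_eq\<close> it would require that both sides of a derivable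
  equation are typed.
\<close>

definition wf_derivable :: "'n mjudgment \<Rightarrow> bool" where
  "wf_derivable S \<longleftrightarrow> mltt_derivable S \<and> wf_context (context_of S)"

section \<open>Typing rules with well-formedness of the context carried along\<close>

lemma empty_wf: "wf_derivable ([] \<turnstile> Ok)"
  by (simp add: wf_derivable_def empty wf_nil)

lemma extend_wf: "\<lbrakk>wf_derivable (\<Gamma> \<turnstile> IsType A); x \<notin> vars \<Gamma>\<rbrakk> \<Longrightarrow> wf_derivable (\<Gamma> @ [(x, A)] \<turnstile> Ok)"
  by (simp add: wf_derivable_def extend wf_snoc)

lemma weakening_wf:
  assumes "wf_derivable (\<Gamma> @ \<Delta> \<turnstile> J)" and "wf_derivable (\<Gamma> \<turnstile> IsType A)" and "x \<notin> vars (\<Gamma> @ \<Delta>)"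
  shows "wf_derivable (\<Gamma> @ [(x, A)] @ \<Delta> \<turnstile> J)"
  using assms weakening[of \<Gamma> \<Delta> J A x] wf_context_insert[of \<Gamma> \<Delta> A x] by (simp add: wf_derivable_def)

lemma substitution_wf:
  assumes "wf_derivable (\<Gamma> @ [(x, A)] @ \<Delta> \<turnstile> J)" and "wf_derivable (\<Gamma> \<turnstile> HasType a A)"
  shows "wf_derivable (\<Gamma> @ subst_context \<Delta> a x \<turnstile> subst_statement J a x)"
  using assms substitution[of \<Gamma> x A \<Delta> J a] wf_context_substitution[of \<Gamma> x A \<Delta> a]
  by (simp add: wf_derivable_def)

lemma substitution_type_eq_wf:
  assumes "wf_derivable (\<Gamma> @ [(x, A)] \<turnstile> IsType B)" and "wf_derivable (\<Gamma> \<turnstile> TermEq a a' A)"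
  shows "wf_derivable (\<Gamma> \<turnstile> TypeEq (B\<langle>a/x\<rangle>) (B\<langle>a'/x\<rangle>))"
  using assms substitution_type_eq[of \<Gamma> x A "[]" B a a'] by (simp add: wf_derivable_def)

lemma term_sym_wf: "wf_derivable (\<Gamma> \<turnstile> TermEq a b A) \<Longrightarrow> wf_derivable (\<Gamma> \<turnstile> TermEq b a A)"
  by (simp add: wf_derivable_def term_sym)

lemma conv_wf:
  "\<lbrakk>wf_derivable (\<Gamma> \<turnstile> HasType a A); wf_derivable (\<Gamma> \<turnstile> TypeEq A B)\<rbrakk> \<Longrightarrow> wf_derivable (\<Gamma> \<turnstile> HasType a B)"
  unfolding wf_derivable_def by (auto intro: conv)

lemma Pi_form_wf:
  "wf_derivable (\<Gamma> @ [(x, A)] \<turnstile> IsType B) \<Longrightarrow> wf_derivable (\<Gamma> \<turnstile> IsType (Pi_type x A B))"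
  by (auto simp: wf_derivable_def intro: Pi_form dest: wf_context_prefix)

lemma Pi_elim_wf:
  "\<lbrakk>wf_derivable (\<Gamma> @ [(x, A)] \<turnstile> IsType B); wf_derivable (\<Gamma> \<turnstile> HasType f (Pi_type x A B));
    wf_derivable (\<Gamma> \<turnstile> HasType a A)\<rbrakk> \<Longrightarrow> wf_derivable (\<Gamma> \<turnstile> HasType (App f a) (B\<langle>a/x\<rangle>))"
  unfolding wf_derivable_def context_of.simps by (elim conjE, rule conjI, rule Pi_elim)

lemma Sigma_form_wf:
  "wf_derivable (\<Gamma> @ [(x, A)] \<turnstile> IsType B) \<Longrightarrow> wf_derivable (\<Gamma> \<turnstile> IsType (Sigma_type x A B))"
  by (auto simp: wf_derivable_def intro: Sigma_form dest: wf_context_prefix)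

lemma Sigma_elim_wf:
  "\<lbrakk>wf_derivable (\<Gamma> @ [(z, Sigma_type x A B)] \<turnstile> IsType C);
    wf_derivable (\<Gamma> @ [(x, A), (y, B)] \<turnstile> HasType d (C\<langle>MkPair (Var x) (Var y)/z\<rangle>));
    wf_derivable (\<Gamma> \<turnstile> HasType p (Sigma_type x A B))\<rbrakk> \<Longrightarrow>
   wf_derivable (\<Gamma> \<turnstile> HasType (split x y d p) (C\<langle>p/z\<rangle>))"
  unfolding wf_derivable_def context_of.simps by (elim conjE, rule conjI, rule Sigma_elim)

lemma Sigma_comp_wf:
  "\<lbrakk>wf_derivable (\<Gamma> @ [(z, Sigma_type x A B)] \<turnstile> IsType C);
    wf_derivable (\<Gamma> @ [(x, A), (y, B)] \<turnstile> HasType d (C\<langle>MkPair (Var x) (Var y)/z\<rangle>));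
    wf_derivable (\<Gamma> \<turnstile> HasType a A); wf_derivable (\<Gamma> \<turnstile> HasType b (B\<langle>a/x\<rangle>))\<rbrakk> \<Longrightarrow>
   wf_derivable (\<Gamma> \<turnstile> TermEq (split x y d (MkPair a b)) (d\<langle>a/x\<rangle>\<langle>b/y\<rangle>) (C\<langle>MkPair a b/z\<rangle>))"
  unfolding wf_derivable_def context_of.simps by (elim conjE, rule conjI, rule Sigma_comp)

lemma Plus_form_wf:
  "\<lbrakk>wf_derivable (\<Gamma> \<turnstile> IsType A); wf_derivable (\<Gamma> \<turnstile> IsType B)\<rbrakk> \<Longrightarrow> wf_derivable (\<Gamma> \<turnstile> IsType (TPlus A B))"
  by (simp add: wf_derivable_def Plus_form)

lemma constant_rules_wf:
  assumes "wf_derivable (\<Gamma> \<turnstile> Ok)"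
  shows One_form_wf: "wf_derivable (\<Gamma> \<turnstile> IsType TOne)"
    and One_intro_wf: "wf_derivable (\<Gamma> \<turnstile> HasType Star TOne)"
    and Zero_form_wf: "wf_derivable (\<Gamma> \<turnstile> IsType TZero)"
    and U_form_wf: "wf_derivable (\<Gamma> \<turnstile> IsType TU)"
  using assms by (simp_all add: wf_derivable_def One_form One_intro Zero_form U_form)

lemma El_form_wf: "wf_derivable (\<Gamma> \<turnstile> HasType a TU) \<Longrightarrow> wf_derivable (\<Gamma> \<turnstile> IsType (TEl a))"
  by (simp add: wf_derivable_def El_form)

lemma wf_context_Ok: "wf_context \<Gamma> \<longleftrightarrow> wf_derivable (\<Gamma> \<turnstile> Ok)"
proof
  show "wf_context \<Gamma> \<Longrightarrow> wf_derivable (\<Gamma> \<turnstile> Ok)"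
    by (induction rule: wf_context.induct) (auto intro: empty extend wf_context.intros simp: wf_derivable_def)
qed (simp add: wf_derivable_def)

section \<open>Inversion of contexts and weakening by blocks\<close>

lemma derivable_Ok: "wf_derivable (\<Gamma> \<turnstile> J) \<Longrightarrow> wf_derivable (\<Gamma> \<turnstile> Ok)"
  by (metis context_of.simps wf_context_Ok wf_derivable_def)

lemma derivable_prefix_Ok: "wf_derivable (\<Gamma> @ \<Delta> \<turnstile> J) \<Longrightarrow> wf_derivable (\<Gamma> \<turnstile> Ok)"
  by (metis derivable_Ok wf_context_Ok wf_context_prefix)

lemma derivable_contextD:
  assumes "wf_derivable (\<Gamma> @ (x, A) # \<Delta> \<turnstile> J)"
  shows "wf_derivable (\<Gamma> \<turnstile> IsType A)" and "x \<notin> vars \<Gamma>"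
proof -
  have "wf_context (\<Gamma> @ [(x, A)])"
    using assms derivable_prefix_Ok[of "\<Gamma> @ [(x, A)]" \<Delta> J] by (simp add: wf_context_Ok)
  then show "wf_derivable (\<Gamma> \<turnstile> IsType A)" "x \<notin> vars \<Gamma>"
    by (auto simp: wf_context_snoc_iff wf_derivable_def)
qed

text \<open>A redeclaration in \<Delta> would extend a prefix that already declares the
  name.\<close>

lemma derivable_context_distinct:
  assumes "wf_derivable (\<Gamma> @ (x, A) # \<Delta> \<turnstile> J)"
  shows "x \<notin> vars \<Delta>"
proof
  assume "x \<in> vars \<Delta>"
  then obtain C where "(x, C) \<in> set \<Delta>" by (force simp: vars_def)
  then obtain \<Delta>\<^sub>1 \<Delta>\<^sub>2 where "\<Delta> = \<Delta>\<^sub>1 @ (x, C) # \<Delta>\<^sub>2" by (meson split_list)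
  then have "wf_derivable ((\<Gamma> @ (x, A) # \<Delta>\<^sub>1) @ (x, C) # \<Delta>\<^sub>2 \<turnstile> J)" using assms by simp
  then show False using derivable_contextD(2) by fastforce
qed

text \<open>The declarations of \<Xi> are inserted from left to right, each behind those already
  inserted, so that its type is well-formed at the point of insertion.\<close>

lemma weakening_context:
  assumes "wf_derivable (\<Gamma> @ \<Delta> \<turnstile> J)" and "wf_derivable (\<Gamma> @ \<Xi> \<turnstile> Ok)" and "vars \<Xi> \<inter> vars \<Delta> = {}"
  shows "wf_derivable (\<Gamma> @ \<Xi> @ \<Delta> \<turnstile> J)"
  using assms(2,3)
proof (induction \<Xi> rule: rev_induct)
  case Nil
  then show ?case using assms(1) by simp
next
  case (snoc a \<Xi>)
  obtain x A where [simp]: "a = (x, A)" by (cases a)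
  have wf: "wf_derivable (\<Gamma> @ \<Xi> \<turnstile> IsType A)" "x \<notin> vars (\<Gamma> @ \<Xi>)"
    using derivable_contextD[of "\<Gamma> @ \<Xi>" x A "[]"] snoc.prems(1) by auto
  have "wf_derivable ((\<Gamma> @ \<Xi>) @ \<Delta> \<turnstile> J)"
    using snoc wf(1) by (auto dest: derivable_Ok)
  then show ?case
    using weakening_wf[of "\<Gamma> @ \<Xi>" \<Delta> J A x] wf snoc.prems(2) by auto
qed

lemma weakening_end:
  "\<lbrakk>wf_derivable (\<Gamma> \<turnstile> J); wf_derivable (\<Gamma> @ \<Xi> \<turnstile> Ok)\<rbrakk> \<Longrightarrow> wf_derivable (\<Gamma> @ \<Xi> \<turnstile> J)"
  using weakening_context[of \<Gamma> "[]" J \<Xi>] by simp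

lemma var_in_context:
  assumes "wf_derivable (\<Gamma> \<turnstile> Ok)" and "(x, A) \<in> set \<Gamma>"
  shows "wf_derivable (\<Gamma> \<turnstile> HasType (Var x) A)"
proof -
  obtain \<Gamma>\<^sub>1 \<Gamma>\<^sub>2 where "\<Gamma> = \<Gamma>\<^sub>1 @ [(x, A)] @ \<Gamma>\<^sub>2"
    using assms(2) by (auto simp: in_set_conv_decomp)
  then show ?thesis using var[of \<Gamma>\<^sub>1 x A \<Gamma>\<^sub>2] assms(1) by (simp add: wf_derivable_def)
qed


section \<open>Non-dependent types and projections\<close>

lemma fresh_name:
  assumes "infinite (UNIV :: 'n set)" and "finite (A :: 'n set)"
  obtains x where "x \<notin> A"
  using assms ex_new_if_finite by blast

text \<open>The formation rules bind a named variable, whereas the non-dependent types leave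
  \<open>B\<close> unclosed. For a fresh name the two agree, because closing does not change
  \<open>B\<close>; this is where an infinite supply of names enters.\<close>

lemma Fun_type_form:
  assumes "infinite (UNIV :: 'n set)"
    and A: "wf_derivable (\<Gamma> \<turnstile> IsType (A :: 'n expr))" and B: "wf_derivable (\<Gamma> \<turnstile> IsType B)"
  shows "wf_derivable (\<Gamma> \<turnstile> IsType (Fun_type A B))"
    and "wf_derivable (\<Gamma> \<turnstile> IsType (Prod_type A B))"
proof -
  obtain x where x: "x \<notin> vars \<Gamma> \<union> fv B"
    using fresh_name[OF assms(1), of "vars \<Gamma> \<union> fv B"] by auto
  have "wf_derivable (\<Gamma> @ [(x, A)] \<turnstile> IsType B)"
    using weakening_end[OF B extend_wf[OF A]] x by simp
  then show "wf_derivable (\<Gamma> \<turnstile> IsType (Fun_type A B))"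
    and "wf_derivable (\<Gamma> \<turnstile> IsType (Prod_type A B))"
    using Pi_form_wf Sigma_form_wf x by (metis UnCI close_fresh)+
qed

text \<open>Elimination with the constant motive \<open>A\<close>; the motive variable
  \<open>z\<close> is fresh so that instantiating it leaves \<open>A\<close> as it is.\<close>

lemma first_typing:
  assumes inf: "infinite (UNIV :: 'n set)"
    and B: "wf_derivable (\<Gamma> @ [(x :: 'n, A)] \<turnstile> IsType B)"
    and p: "wf_derivable (\<Gamma> \<turnstile> HasType p (Sigma_type x A B))"
  shows "wf_derivable (\<Gamma> \<turnstile> HasType (first p) A)"
proof -
  have A: "wf_derivable (\<Gamma> \<turnstile> IsType A)" and x: "x \<notin> vars \<Gamma>"
    using derivable_contextD[of \<Gamma> x A "[]"] B by auto
  obtain z where z: "z \<notin> vars \<Gamma> \<union> fv A"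
    using fresh_name[OF inf, of "vars \<Gamma> \<union> fv A"] by auto
  \<comment> \<open>\<open>y\<close> differs from \<open>x\<close> so that closing
    \<open>Var x\<close> by \<open>y\<close> and then by \<open>x\<close> gives
    \<open>Bound 1\<close>, the body of \<open>first\<close>.\<close>
  obtain y where y: "y \<notin> insert x (vars \<Gamma>)"
    using fresh_name[OF inf, of "insert x (vars \<Gamma>)"] by auto
  have C: "wf_derivable (\<Gamma> @ [(z, Sigma_type x A B)] \<turnstile> IsType A)"
    using weakening_end[OF A extend_wf[OF Sigma_form_wf[OF B]]] z by simp
  have "wf_derivable ((\<Gamma> @ [(x, A)]) @ [(y, B)] \<turnstile> Ok)"
    using extend_wf[OF B] y by simp
  then have "wf_derivable (\<Gamma> @ [(x, A), (y, B)] \<turnstile> HasType (Var x) (A\<langle>MkPair (Var x) (Var y)/z\<rangle>))"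
    using z by (auto intro: var_in_context simp: subst_fresh)
  from Sigma_elim_wf[OF C this p] show ?thesis
    using y z by (auto simp: first_def subst_fresh)
qed

lemma first_comp:
  assumes inf: "infinite (UNIV :: 'n set)"
    and B: "wf_derivable (\<Gamma> @ [(x :: 'n, A)] \<turnstile> IsType B)"
    and a: "wf_derivable (\<Gamma> \<turnstile> HasType a A)" and b: "wf_derivable (\<Gamma> \<turnstile> HasType b (B\<langle>a/x\<rangle>))"
  shows "wf_derivable (\<Gamma> \<turnstile> TermEq (first (MkPair a b)) a A)"
proof -
  have A: "wf_derivable (\<Gamma> \<turnstile> IsType A)" and x: "x \<notin> vars \<Gamma>"
    using derivable_contextD[of \<Gamma> x A "[]"] B by auto
  obtain z where z: "z \<notin> vars \<Gamma> \<union> fv A"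
    using fresh_name[OF inf, of "vars \<Gamma> \<union> fv A"] by auto
  \<comment> \<open>\<open>y\<close> also avoids \<open>a\<close>: the computation rule substitutes
    for \<open>y\<close> after \<open>a\<close> has been put in for \<open>x\<close>.\<close>
  obtain y where y: "y \<notin> insert x (vars \<Gamma>) \<union> fv a"
    using fresh_name[OF inf, of "insert x (vars \<Gamma>) \<union> fv a"] by auto
  have C: "wf_derivable (\<Gamma> @ [(z, Sigma_type x A B)] \<turnstile> IsType A)"
    using weakening_end[OF A extend_wf[OF Sigma_form_wf[OF B]]] z by simp
  have "wf_derivable ((\<Gamma> @ [(x, A)]) @ [(y, B)] \<turnstile> Ok)"
    using extend_wf[OF B] y by simp
  then have "wf_derivable (\<Gamma> @ [(x, A), (y, B)] \<turnstile> HasType (Var x) (A\<langle>MkPair (Var x) (Var y)/z\<rangle>))"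
    using z by (auto intro: var_in_context simp: subst_fresh)
  from Sigma_comp_wf[OF C this a b] show ?thesis
    using y z by (auto simp: first_def subst_fresh)
qed

text \<open>
  The motive is \<open>B\<langle>first z/x\<rangle>\<close>; the second component \<open>y : B\<close> has type \<open>B\<langle>first (x, y)/x\<rangle>\<close> only up
  to the judgmental equality \<open>first (x, y) = x\<close>, which is stated in a context that already
  contains \<open>x\<close>; this is why a renamed copy of \<open>x\<close> appears.
\<close>

lemma second_typing:
  assumes inf: "infinite (UNIV :: 'n set)"
    and B: "wf_derivable (\<Gamma> @ [(x :: 'n, A)] \<turnstile> IsType B)"
    and p: "wf_derivable (\<Gamma> \<turnstile> HasType p (Sigma_type x A B))"
  shows "wf_derivable (\<Gamma> \<turnstile> HasType (second p) (B\<langle>first p/x\<rangle>))"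
proof -
  have A: "wf_derivable (\<Gamma> \<turnstile> IsType A)" and x: "x \<notin> vars \<Gamma>"
    using derivable_contextD[of \<Gamma> x A "[]"] B by auto
  define N where "N = insert x (vars \<Gamma>) \<union> fv A \<union> fv B"
  have "finite N" by (simp add: N_def)
  obtain z where z: "z \<notin> N" using fresh_name[OF inf \<open>finite N\<close>] by auto
  obtain y where y: "y \<notin> N" using fresh_name[OF inf \<open>finite N\<close>] by auto
  obtain x' where x': "x' \<notin> insert y N" using fresh_name[OF inf, of "insert y N"] \<open>finite N\<close> by auto
  note fresh = z y x' x N_def
  let ?S = "Sigma_type x A B"
  let ?\<Gamma>' = "\<Gamma> @ [(x, A), (y, B)]"
  have S: "wf_derivable (\<Gamma> \<turnstile> IsType ?S)" by (rule Sigma_form_wf[OF B])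
  have z_ok: "wf_derivable (\<Gamma> @ [(z, ?S)] \<turnstile> Ok)"
    using extend_wf[OF S] fresh by simp
  have Bz: "wf_derivable ((\<Gamma> @ [(z, ?S)]) @ [(x, A)] \<turnstile> IsType B)"
    using weakening_context[OF B z_ok] fresh by auto
  have "wf_derivable (\<Gamma> @ [(z, ?S)] \<turnstile> HasType (first (Var z)) A)"
    using first_typing[OF inf Bz] var_in_context[OF z_ok] by simp
  then have C: "wf_derivable (\<Gamma> @ [(z, ?S)] \<turnstile> IsType (B\<langle>first (Var z)/x\<rangle>))"
    using substitution_wf[of "\<Gamma> @ [(z, ?S)]" x A "[]" "IsType B"] Bz by simp
  have ok: "wf_derivable (?\<Gamma>' \<turnstile> Ok)"
    using extend_wf[OF B, of y] fresh by simp
  have "wf_derivable (\<Gamma> @ [(x', A)] \<turnstile> Ok)"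
    using extend_wf[OF A] fresh by simp
  then have x'x: "wf_derivable (\<Gamma> @ [(x', A)] @ [(x, A)] \<turnstile> IsType B)"
    and "wf_derivable (\<Gamma> @ [(x', A)] \<turnstile> HasType (Var x') A)"
    using weakening_context[OF B, of "[(x', A)]"] fresh by (auto intro: var_in_context)
  then have "wf_derivable (\<Gamma> @ [(x', A)] \<turnstile> IsType (B\<langle>Var x'/x\<rangle>))"
    using substitution_wf[of "\<Gamma> @ [(x', A)]" x A "[]" "IsType B"] by simp
  then have Bx': "wf_derivable (?\<Gamma>' @ [(x', A)] \<turnstile> IsType (B\<langle>Var x'/x\<rangle>))"
    using weakening_context[of \<Gamma> "[(x', A)]" _ "[(x, A), (y, B)]"] ok fresh by auto
  have rename: "B\<langle>Var x'/x\<rangle>\<langle>u/x'\<rangle> = B\<langle>u/x\<rangle>" for u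
    using fresh by (simp add: subst_subst_fresh)
  have "wf_derivable (?\<Gamma>' \<turnstile> TermEq (first (MkPair (Var x) (Var y))) (Var x) A)"
    using first_comp[OF inf Bx', of "Var x" "Var y"] var_in_context[OF ok]
    by (simp add: rename subst_self)
  then have "wf_derivable (?\<Gamma>' \<turnstile> TypeEq B (B\<langle>first (MkPair (Var x) (Var y))/x\<rangle>))"
    using substitution_type_eq_wf[of ?\<Gamma>' x' A "B\<langle>Var x'/x\<rangle>"] Bx' term_sym_wf
    by (fastforce simp: rename subst_self)
  moreover have "wf_derivable (?\<Gamma>' \<turnstile> HasType (Var y) B)"
    using var_in_context[OF ok] by simp
  ultimately have "wf_derivable (?\<Gamma>' \<turnstile> HasType (Var y) (B\<langle>first (Var z)/x\<rangle>\<langle>MkPair (Var x) (Var y)/z\<rangle>))"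
    using conv_wf fresh by (fastforce simp: subst_subst_fresh)
  from Sigma_elim_wf[OF C this p] show ?thesis
    using fresh by (auto simp: second_def subst_subst_fresh)
qed


section \<open>Iterated sums\<close>

text \<open>The iterated sum for an arbitrary context. Substituting a projection for the first
  variable leaves the family of object types but stays within contexts, which is what an induction
  on the tail requires.\<close>

fun sigma_over :: "'n mcontext \<Rightarrow> 'n expr" where
  "sigma_over [] = TOne"
| "sigma_over [(x, A)] = A"
| "sigma_over ((x, A) # b # \<Psi>) = Sigma_type x A (sigma_over (b # \<Psi>))"

text \<open>The pairs are listed in the order in which they are substituted. Every term has just the
  free variables of \<open>p\<close>, so later substitutions do not disturb earlier ones when
  \<open>p\<close> avoids the names.\<close>

fun projections :: "'n list \<Rightarrow> 'n expr \<Rightarrow> ('n \<times> 'n expr) list" where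
  "projections [] p = []"
| "projections [x] p = [(x, p)]"
| "projections (x # y # xs) p = (x, first p) # projections (y # xs) (second p)"

lemma projections_fv: "(x, u) \<in> set (projections xs p) \<Longrightarrow> x \<in> set xs \<and> fv u = fv p"
  by (induction xs p rule: projections.induct) auto

lemma sigma_over_type:
  "wf_derivable (\<Gamma> @ \<Psi> \<turnstile> Ok) \<Longrightarrow> wf_derivable (\<Gamma> \<turnstile> IsType (sigma_over \<Psi>))"
proof (induction \<Psi> arbitrary: \<Gamma> rule: sigma_over.induct)
  case 1
  then show ?case by (auto intro: One_form_wf)
next
  case (2 x A)
  then show ?case using derivable_contextD by fastforce
next
  case (3 x A b \<Psi>)
  then show ?case using 3(1)[of "\<Gamma> @ [(x, A)]"] Sigma_form_wf by fastforce
qed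

lemma sigma_over_subst:
  "\<lbrakk>x \<notin> vars \<Psi>; fv u \<inter> vars \<Psi> = {}\<rbrakk> \<Longrightarrow> (sigma_over \<Psi>)\<langle>u/x\<rangle> = sigma_over (subst_context \<Psi> u x)"
proof (induction \<Psi> rule: sigma_over.induct)
  case (3 y A b \<Psi>)
  obtain z B where [simp]: "b = (z, B)" by (cases b)
  show ?case using 3 by (auto simp: subst_close)
qed auto

section \<open>Sequences of substitutions\<close>

abbreviation subst_all :: "'n expr \<Rightarrow> ('n \<times> 'n expr) list \<Rightarrow> 'n expr" where
  "subst_all \<equiv> foldl (\<lambda>t (x, u). t\<langle>u/x\<rangle>)"

abbreviation subst_all_context :: "'n mcontext \<Rightarrow> ('n \<times> 'n expr) list \<Rightarrow> 'n mcontext" where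
  "subst_all_context \<equiv> foldl (\<lambda>\<Delta> (x, u). subst_context \<Delta> u x)"

abbreviation subst_all_statement :: "'n mstatement \<Rightarrow> ('n \<times> 'n expr) list \<Rightarrow> 'n mstatement" where
  "subst_all_statement \<equiv> foldl (\<lambda>J (x, u). subst_statement J u x)"

lemma map_fst_subst_context [simp]: "map fst (subst_context \<Delta> u x) = map fst \<Delta>"
  by (auto simp: subst_context_def)

text \<open>Once \<open>first p\<close> replaces the first variable, \<open>second p\<close>
  inhabits the sum over the instantiated tail, so the induction continues with
  \<open>second p\<close> in the same \<Gamma>. The freshness of \<open>p\<close> prevents capture
  by the binders of the sum.\<close>

lemma substitution_projections:
  assumes "infinite (UNIV :: 'n set)"
    and "wf_derivable (\<Gamma> @ \<Psi> @ \<Delta> \<turnstile> J)"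
    and "wf_derivable (\<Gamma> \<turnstile> HasType p (sigma_over (\<Psi> :: 'n mcontext)))"
    and "fv p \<inter> vars \<Psi> = {}"
  shows "wf_derivable (\<Gamma> @ subst_all_context \<Delta> (projections (map fst \<Psi>) p)
           \<turnstile> subst_all_statement J (projections (map fst \<Psi>) p))"
  using assms(2-)
proof (induction "map fst \<Psi>" p arbitrary: \<Psi> \<Delta> J rule: projections.induct)
  case (1 p)
  then show ?case by simp
next
  case (2 x p)
  then obtain A where "\<Psi> = [(x, A)]" by auto
  then show ?case using 2 substitution_wf[of \<Gamma> x A \<Delta> J p] by auto
next
  case (3 x y xs p)
  then obtain A B \<Psi>' where \<Psi>: "\<Psi> = (x, A) # (y, B) # \<Psi>'" by fastforce
  let ?\<Psi>' = "(y, B) # \<Psi>'"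
  have ok: "wf_derivable (\<Gamma> @ (x, A) # ?\<Psi>' \<turnstile> Ok)"
    using 3(3) \<Psi> derivable_prefix_Ok[of "\<Gamma> @ (x, A) # ?\<Psi>'" \<Delta>] by simp
  have x: "x \<notin> vars ?\<Psi>'"
    by (rule derivable_context_distinct[OF ok])
  have B: "wf_derivable (\<Gamma> @ [(x, A)] \<turnstile> IsType (sigma_over ?\<Psi>'))"
    using sigma_over_type[of "\<Gamma> @ [(x, A)]" ?\<Psi>'] ok by simp
  have p: "wf_derivable (\<Gamma> \<turnstile> HasType p (Sigma_type x A (sigma_over ?\<Psi>')))"
    using 3(4) \<Psi> by simp
  have "wf_derivable (\<Gamma> \<turnstile> HasType (first p) A)"
    by (rule first_typing[OF assms(1) B p])
  then have J: "wf_derivable (\<Gamma> @ subst_context ?\<Psi>' (first p) x @ subst_context \<Delta> (first p) x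
      \<turnstile> subst_statement J (first p) x)"
    using substitution_wf[of \<Gamma> x A "?\<Psi>' @ \<Delta>" J "first p"] 3(3) \<Psi> by simp
  have fresh: "fv p \<inter> vars ?\<Psi>' = {}"
    using 3(5) \<Psi> by auto
  have "wf_derivable (\<Gamma> \<turnstile> HasType (second p) (sigma_over (subst_context ?\<Psi>' (first p) x)))"
    using second_typing[OF assms(1) B p] sigma_over_subst[of x ?\<Psi>' "first p"] x fresh by simp
  from 3(1)[OF _ J this] show ?case
    using 3(2) \<Psi> fresh by auto
qed

section \<open>The interpretation over object variables\<close>

text \<open>
  \<open>h K\<close> is the term that stands for the object \<open>K\<close>: the \<open>K\<close>-th projection of the structure for the
  interpretation proper, and a variable for the intermediate one.
\<close>

primrec sort_over :: "('o \<Rightarrow> ('o, 'a) name expr) \<Rightarrow> 'o sort \<Rightarrow> ('o, 'a) name expr" where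
  "sort_over h (Sort K xs) = TEl (app (h K) (map (\<lambda>x. Var (LogName x)) xs))"

primrec formula_over :: "('o \<Rightarrow> ('o, 'a) name expr) \<Rightarrow> 'o formula \<Rightarrow> ('o, 'a) name expr" where
  "formula_over h Bot = TZero"
| "formula_over h Top = TOne"
| "formula_over h (And \<phi> \<psi>) = Prod_type (formula_over h \<phi>) (formula_over h \<psi>)"
| "formula_over h (Or \<phi> \<psi>) = TPlus (formula_over h \<phi>) (formula_over h \<psi>)"
| "formula_over h (Imp \<phi> \<psi>) = Fun_type (formula_over h \<phi>) (formula_over h \<psi>)"
| "formula_over h (All x S \<phi>) = Pi_type (LogName x) (sort_over h S) (formula_over h \<phi>)"
| "formula_over h (Ex x S \<phi>) = Sigma_type (LogName x) (sort_over h S) (formula_over h \<phi>)"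

definition context_over ::
  "('o \<Rightarrow> ('o, 'a) name expr) \<Rightarrow> 'o lcontext \<Rightarrow> ('o, 'a) name mcontext" where
  "context_over h \<Gamma> = map (\<lambda>(x, S). (LogName x, sort_over h S)) \<Gamma>"

primrec statement_over ::
  "('o \<Rightarrow> ('o, 'a) name expr) \<Rightarrow> 'o lstatement \<Rightarrow> ('o, 'a) name mstatement" where
  "statement_over h LOk = Ok"
| "statement_over h (LSort S) = IsType (sort_over h S)"
| "statement_over h (LHasSort x S) = HasType (Var (LogName x)) (sort_over h S)"
| "statement_over h (LFormula \<phi>) = IsType (formula_over h \<phi>)"

lemma interp_eq_over:
  fixes os :: "'o list"
  shows "interp \<L> os as (\<Gamma> \<turnstile>\<^sub>L J) =
     ((StrName, Struc \<L> os as) # context_over (component os (Var StrName)) \<Gamma>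
        \<turnstile> statement_over (component os (Var StrName)) J)"
proof -
  have S: "interp_sort os S = sort_over (component os (Var StrName)) S" for S :: "'o sort"
    by (cases S) simp
  have F: "interp_formula os \<phi> = formula_over (component os (Var StrName)) \<phi>" for \<phi> :: "'o formula"
    by (induction \<phi>) (auto simp: S)
  show ?thesis
    by (cases J) (auto simp: interp_context_def context_over_def S F)
qed

lemma context_over_simps [simp]:
  "context_over h [] = []"
  "context_over h ((x, S) # \<Gamma>) = (LogName x, sort_over h S) # context_over h \<Gamma>"
  "context_over h (\<Gamma> @ \<Delta>) = context_over h \<Gamma> @ context_over h \<Delta>"
  by (auto simp: context_over_def)

lemma vars_context_over [simp]: "vars (context_over h \<Gamma>) = LogName ` vars \<Gamma>"
  by (force simp: vars_def context_over_def)

section \<open>Changing the terms that stand for objects\<close>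

lemma sort_over_subst:
  assumes "\<And>x. z \<noteq> LogName x"
  shows "(sort_over h S)\<langle>u/z\<rangle> = sort_over (\<lambda>K. (h K)\<langle>u/z\<rangle>) S"
  using assms[symmetric] by (cases S) (simp add: subst_app comp_def)

lemma formula_over_subst:
  assumes "\<And>x. z \<noteq> LogName x" and "\<And>x. LogName x \<notin> fv u"
  shows "(formula_over h \<phi>)\<langle>u/z\<rangle> = formula_over (\<lambda>K. (h K)\<langle>u/z\<rangle>) \<phi>"
  using assms(1)[symmetric] assms(2)
  by (induction \<phi>) (auto simp: subst_close sort_over_subst[OF assms(1)])

lemma context_over_subst:
  assumes "\<And>x. z \<noteq> LogName x"
  shows "subst_context (context_over h \<Gamma>) u z = context_over (\<lambda>K. (h K)\<langle>u/z\<rangle>) \<Gamma>"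
  by (induction \<Gamma>) (auto simp: sort_over_subst[OF assms])

lemma statement_over_subst:
  assumes "\<And>x. z \<noteq> LogName x" and "\<And>x. LogName x \<notin> fv u"
  shows "subst_statement (statement_over h J) u z = statement_over (\<lambda>K. (h K)\<langle>u/z\<rangle>) J"
  using assms(1)[symmetric]
  by (cases J) (auto simp: sort_over_subst[OF assms(1)] formula_over_subst[OF assms])

text \<open>Substituting for a name that is not logical acts only through \<open>h\<close>, so a
  sequence of substitutions is absorbed into \<open>h\<close> step by step. The inserted terms must
  avoid logical names because quantifiers bind those.\<close>

lemma over_subst_all:
  assumes "\<And>z u x. (z, u) \<in> set \<theta> \<Longrightarrow> z \<noteq> LogName x \<and> LogName x \<notin> fv u"
  shows "subst_all_context (context_over h \<Gamma>) \<theta> = context_over (\<lambda>K. subst_all (h K) \<theta>) \<Gamma>"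
    and "subst_all_statement (statement_over h J) \<theta> = statement_over (\<lambda>K. subst_all (h K) \<theta>) J"
proof -
  have "subst_all_context (context_over h \<Gamma>) \<theta> = context_over (\<lambda>K. subst_all (h K) \<theta>) \<Gamma> \<and>
    subst_all_statement (statement_over h J) \<theta> = statement_over (\<lambda>K. subst_all (h K) \<theta>) J"
    using assms
  proof (induction \<theta> arbitrary: h)
    case (Cons a \<theta>)
    obtain z u where [simp]: "a = (z, u)" by (cases a)
    have z: "z \<noteq> LogName x" "LogName x \<notin> fv u" for x using Cons.prems by auto
    show ?case
      using Cons.IH Cons.prems by (auto simp: context_over_subst[OF z(1)] statement_over_subst[OF z])
  qed simp
  then show "subst_all_context (context_over h \<Gamma>) \<theta> = context_over (\<lambda>K. subst_all (h K) \<theta>) \<Gamma>"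
    and "subst_all_statement (statement_over h J) \<theta> = statement_over (\<lambda>K. subst_all (h K) \<theta>) J"
    by simp_all
qed

lemma subst_all_fresh: "fst ` set \<theta> \<inter> fv t = {} \<Longrightarrow> subst_all t \<theta> = t"
  by (induction \<theta>) (auto simp: subst_fresh)

lemma subst_all_projections:
  assumes "distinct os" and "K \<in> set os" and "fv p \<inter> range ObjName = {}"
  shows "subst_all (Var (ObjName K)) (projections (map ObjName os) p) = component os p K"
  using assms
proof (induction os p K rule: component.induct)
  case (3 K' K'' Ks p K)
  have "subst_all (first p) (projections (map ObjName (K'' # Ks)) (second p)) = first p"
    using 3(4) projections_fv by (intro subst_all_fresh) fastforce
  then show ?case using 3 by auto
qed auto

lemma component_fv: "fv (component os p K) = fv p"
  by (induction os p K rule: component.induct) auto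

lemma infinite_name: "infinite (UNIV :: ('o, 'a) name set)"
proof -
  have "inj (LogName :: lvar \<Rightarrow> ('o, 'a) name)" by (auto intro: injI)
  then show ?thesis
    using finite_imageD[of LogName UNIV] finite_subset[OF subset_UNIV] infinite_UNIV_nat by metis
qed

text \<open>Sortedness excludes \<open>x\<close> from the part after \<open>y\<close>, and
  irreflexivity excludes \<open>x = y\<close>; for a partial order this is all that a listing
  guarantees.\<close>

lemma lists_increasingly_before:
  assumes "lists_increasingly lt X (xs @ y # ys)" and "irreflp_on X lt" and "x \<in> X" and "lt x y"
  shows "x \<in> set xs"
proof -
  have "x \<noteq> y" using assms by (auto simp: irreflp_on_def lists_increasingly_def)
  moreover have "x \<notin> set ys"
    using assms(1,4) by (auto simp: lists_increasingly_def sorted_wrt_append)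
  ultimately show ?thesis using assms(1,3) by (auto simp: lists_increasingly_def)
qed

section \<open>What the listing order guarantees\<close>

locale listed_signature =
  fixes \<L> :: "('o, 'a) signature" and os :: "'o list" and as :: "'o \<Rightarrow> 'a list"
  assumes folds: "folds_signature \<L>" and listing: "increasing_listing \<L> os as"
begin

lemma category: "is_category \<L>"
  using folds by (simp add: folds_signature_def inverse_category_def)

lemma set_os: "set os = Obj \<L>" and distinct_os: "distinct os"
  using listing by (auto simp: increasing_listing_def lists_increasingly_def)

lemma set_as: "K \<in> Obj \<L> \<Longrightarrow> set (as K) = arrows_from \<L> K"
  and distinct_as: "K \<in> Obj \<L> \<Longrightarrow> distinct (as K)"
  using listing by (auto simp: increasing_listing_def lists_increasingly_def)

lemma obj_less_Cod: "K \<in> Obj \<L> \<Longrightarrow> f \<in> arrows_from \<L> K \<Longrightarrow> obj_less \<L> (Cod \<L> f) K"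
  using folds by (simp add: folds_signature_def proper_order_def)

lemma arrows_fromD:
  assumes "f \<in> arrows_from \<L> K"
  shows "f \<in> Arr \<L>" and "Dom \<L> f = K" and "Cod \<L> f \<in> Obj \<L>"
  using assms category by (auto simp: arrows_from_def is_category_def)

lemma Cod_before: "os = Ks @ K # Ks' \<Longrightarrow> f \<in> arrows_from \<L> K \<Longrightarrow> Cod \<L> f \<in> set Ks"
proof (rule lists_increasingly_before)
  assume *: "os = Ks @ K # Ks'" "f \<in> arrows_from \<L> K"
  show "lists_increasingly (obj_less \<L>) (Obj \<L>) (Ks @ K # Ks')"
    using listing * by (simp add: increasing_listing_def)
  show "irreflp_on (Obj \<L>) (obj_less \<L>)"
    using folds by (simp add: folds_signature_def proper_order_def strict_partial_order_on_def)
  show "Cod \<L> f \<in> Obj \<L>" using * arrows_fromD by blast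
  have "K \<in> Obj \<L>" using * set_os by auto
  then show "obj_less \<L> (Cod \<L> f) K" using * obj_less_Cod by blast
qed

text \<open>The composite cannot be the identity, because its codomain lies strictly below
  \<open>K\<close>.\<close>

lemma Cmp_arrows_from:
  assumes "K \<in> Obj \<L>" and f: "f \<in> arrows_from \<L> K" and p: "p \<in> arrows_from \<L> (Cod \<L> f)"
  shows "Cmp \<L> p f \<in> arrows_from \<L> K" and "Cod \<L> (Cmp \<L> p f) = Cod \<L> p"
proof -
  have c: "Cmp \<L> p f \<in> Arr \<L>" "Dom \<L> (Cmp \<L> p f) = K" "Cod \<L> (Cmp \<L> p f) = Cod \<L> p"
    using category arrows_fromD[OF f] arrows_fromD[OF p] by (auto simp: is_category_def)
  then show "Cod \<L> (Cmp \<L> p f) = Cod \<L> p" by simp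
  have "obj_less \<L> (Cod \<L> p) (Cod \<L> f)" "obj_less \<L> (Cod \<L> f) K"
    using obj_less_Cod assms arrows_fromD by blast+
  then have "obj_less \<L> (Cod \<L> p) K"
    using folds assms arrows_fromD[OF f] arrows_fromD[OF p]
    by (auto simp: folds_signature_def proper_order_def strict_partial_order_on_def elim: transp_onD)
  then have "Cod \<L> p \<noteq> K"
    using folds assms(1)
    by (auto simp: folds_signature_def proper_order_def strict_partial_order_on_def irreflp_on_def)
  moreover have "Cod \<L> (Idn \<L> K) = K"
    using category assms(1) by (simp add: is_category_def)
  ultimately show "Cmp \<L> p f \<in> arrows_from \<L> K"
    using c by (auto simp: arrows_from_def)
qed

text \<open>The codomain of the composite is that of \<open>p\<close>, strictly below the codomain
  of \<open>f\<close>, and a proper order on arrows respects strict inequality of codomains.\<close>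

lemma Cmp_before:
  assumes K: "K \<in> Obj \<L>" and as: "as K = fs @ f # gs" and p: "p \<in> set (as (Cod \<L> f))"
  shows "Cmp \<L> p f \<in> set fs"
proof (rule lists_increasingly_before)
  have f: "f \<in> arrows_from \<L> K" using K as set_as by force
  have p': "p \<in> arrows_from \<L> (Cod \<L> f)" using p set_as arrows_fromD[OF f] by blast
  note c = Cmp_arrows_from[OF K f p']
  show "lists_increasingly (arr_less \<L>) (arrows_from \<L> K) (fs @ f # gs)"
    using listing K as by (metis increasing_listing_def)
  show "irreflp_on (arrows_from \<L> K) (arr_less \<L>)"
    using folds by (auto simp: folds_signature_def proper_order_def strict_partial_order_on_def
        irreflp_on_def arrows_from_def)
  show "Cmp \<L> p f \<in> arrows_from \<L> K" by (rule c)
  have "obj_less \<L> (Cod \<L> (Cmp \<L> p f)) (Cod \<L> f)"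
    using obj_less_Cod[OF arrows_fromD(3)[OF f] p'] c by simp
  then show "arr_less \<L> (Cmp \<L> p f) f"
    using folds arrows_fromD(1)[OF f] arrows_fromD(1)[OF c(1)]
    by (auto simp: folds_signature_def proper_order_def)
qed

section \<open>Argument telescopes and the types of object variables\<close>

definition arg_type :: "('a \<Rightarrow> ('o, 'a) name) \<Rightarrow> 'a \<Rightarrow> ('o, 'a) name expr" where
  "arg_type \<rho> f =
     TEl (app (Var (ObjName (Cod \<L> f))) (map (\<lambda>p. Var (\<rho> (Cmp \<L> p f))) (as (Cod \<L> f))))"

definition arg_context :: "('a \<Rightarrow> ('o, 'a) name) \<Rightarrow> 'a list \<Rightarrow> ('o, 'a) name mcontext" where
  "arg_context \<rho> fs = map (\<lambda>f. (ArrName f, arg_type \<rho> f)) fs"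

text \<open>\<open>\<rho> h\<close> is the variable standing for the arrow \<open>h\<close>. The
  choice \<open>ArrName\<close> gives the type of an object variable; other choices describe what
  remains of it after some arguments have been supplied.\<close>

definition pi_over :: "('a \<Rightarrow> ('o, 'a) name) \<Rightarrow> 'a list \<Rightarrow> ('o, 'a) name expr" where
  "pi_over \<rho> fs = foldr (\<lambda>f. Pi_type (ArrName f) (arg_type \<rho> f)) fs TU"

definition object_context :: "'o list \<Rightarrow> ('o, 'a) name mcontext" where
  "object_context Ks = map (\<lambda>K. (ObjName K, object_type \<L> as K)) Ks"

lemma vars_arg_context [simp]: "vars (arg_context \<rho> fs) = ArrName ` set fs"
  by (force simp: vars_def arg_context_def)

lemma vars_object_context [simp]: "vars (object_context Ks) = ObjName ` set Ks"
  by (force simp: vars_def object_context_def)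

lemma arg_context_simps [simp]:
  "arg_context \<rho> [] = []"
  "arg_context \<rho> (f # fs) = (ArrName f, arg_type \<rho> f) # arg_context \<rho> fs"
  "arg_context \<rho> (fs @ gs) = arg_context \<rho> fs @ arg_context \<rho> gs"
  by (simp_all add: arg_context_def)

lemma object_context_simps [simp]:
  "object_context [] = []"
  "object_context (K # Ks) = (ObjName K, object_type \<L> as K) # object_context Ks"
  "object_context (Ks @ Ks') = object_context Ks @ object_context Ks'"
  by (simp_all add: object_context_def)

lemma object_type_eq:
  "object_type \<L> as K =
     (if arrows_from \<L> K = {} then Fun_type TOne TU else pi_over ArrName (as K))"
  by (simp add: object_type_def pi_over_def arg_type_def)

lemma pi_over_type:
  "wf_derivable (\<Gamma> @ arg_context \<rho> fs \<turnstile> Ok) \<Longrightarrow> wf_derivable (\<Gamma> \<turnstile> IsType (pi_over \<rho> fs))"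
proof (induction fs arbitrary: \<Gamma>)
  case Nil
  then show ?case by (simp add: pi_over_def U_form_wf)
next
  case (Cons f fs)
  then show ?case
    using Pi_form_wf Cons.IH[of "\<Gamma> @ [(ArrName f, arg_type \<rho> f)]"] by (fastforce simp: pi_over_def)
qed

lemma arg_type_subst:
  "(arg_type \<rho> f)\<langle>Var v/ArrName g\<rangle> = arg_type (\<lambda>h. if \<rho> h = ArrName g then v else \<rho> h) f"
  by (auto simp: arg_type_def subst_app comp_def intro!: arg_cong[where f = "app _"])

lemma pi_over_subst:
  "\<lbrakk>g \<notin> set fs; v \<notin> ArrName ` set fs\<rbrakk> \<Longrightarrow>
   (pi_over \<rho> fs)\<langle>Var v/ArrName g\<rangle> = pi_over (\<lambda>h. if \<rho> h = ArrName g then v else \<rho> h) fs"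
  by (induction fs) (auto simp: pi_over_def arg_type_subst subst_close)

lemma arg_context_subst:
  "subst_context (arg_context \<rho> fs) (Var v) (ArrName g) =
     arg_context (\<lambda>h. if \<rho> h = ArrName g then v else \<rho> h) fs"
  by (induction fs) (auto simp: arg_type_subst)

text \<open>
  The arguments in \<open>gs\<close> have already been supplied. The composites occurring in the type of the next
  argument are all listed before it, so that this type no longer mentions bound variables.
\<close>

lemma foldl_App_typing:
  assumes K: "K \<in> Obj \<L>" and "as K = gs @ fs"
    and y: "\<And>f. f \<in> set (as K) \<Longrightarrow> wf_derivable (\<Theta> \<turnstile> HasType (Var (y f)) (arg_type y f))"
    and fresh: "\<And>f. f \<in> set (as K) \<Longrightarrow> y f \<notin> ArrName ` set (as K)"
    and "wf_derivable (\<Theta> @ arg_context (\<lambda>h. if h \<in> set gs then y h else ArrName h) fs \<turnstile> Ok)"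
    and "wf_derivable (\<Theta> \<turnstile> HasType F (pi_over (\<lambda>h. if h \<in> set gs then y h else ArrName h) fs))"
  shows "wf_derivable (\<Theta> \<turnstile> HasType (foldl App F (map (\<lambda>f. Var (y f)) fs)) TU)"
  using assms(2,5,6)
proof (induction fs arbitrary: gs F)
  case Nil
  then show ?case by (simp add: pi_over_def)
next
  case (Cons f fs)
  define \<rho> where "\<rho> gs = (\<lambda>h. if h \<in> set gs then y h else ArrName h)" for gs
  \<comment> \<open>By freshness no supplied variable is \<open>ArrName f\<close>, so the
    substitution changes the entry of \<open>f\<close> alone.\<close>
  have step: "(\<lambda>h. if \<rho> gs h = ArrName f then y f else \<rho> gs h) = \<rho> (gs @ [f])"
    using fresh Cons.prems(1) by (fastforce simp: \<rho>_def)
  have "arg_type (\<rho> gs) f = arg_type y f"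
    using Cmp_before[OF K Cons.prems(1)] by (auto simp: arg_type_def \<rho>_def intro!: arg_cong[where f = "app _"])
  then have yf: "wf_derivable (\<Theta> \<turnstile> HasType (Var (y f)) (arg_type (\<rho> gs) f))"
    using y Cons.prems(1) by simp
  have ok: "wf_derivable (\<Theta> @ [(ArrName f, arg_type (\<rho> gs) f)] @ arg_context (\<rho> gs) fs \<turnstile> Ok)"
    using Cons.prems(2) by (simp add: \<rho>_def)
  have "wf_derivable (\<Theta> @ [(ArrName f, arg_type (\<rho> gs) f)] \<turnstile> IsType (pi_over (\<rho> gs) fs))"
    using pi_over_type[of "\<Theta> @ [(ArrName f, arg_type (\<rho> gs) f)]"] ok by simp
  moreover have "wf_derivable (\<Theta> \<turnstile> HasType F (Pi_type (ArrName f) (arg_type (\<rho> gs) f) (pi_over (\<rho> gs) fs)))"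
    using Cons.prems(3) by (simp add: pi_over_def \<rho>_def)
  ultimately have "wf_derivable (\<Theta> \<turnstile> HasType (App F (Var (y f))) ((pi_over (\<rho> gs) fs)\<langle>Var (y f)/ArrName f\<rangle>))"
    using yf by (rule Pi_elim_wf)
  moreover have "f \<notin> set fs" "y f \<notin> ArrName ` set fs"
    using distinct_as[OF K] fresh[of f] Cons.prems(1) by auto
  ultimately have F: "wf_derivable (\<Theta> \<turnstile> HasType (App F (Var (y f))) (pi_over (\<rho> (gs @ [f])) fs))"
    by (simp add: pi_over_subst step)
  have "wf_derivable (\<Theta> @ arg_context (\<rho> (gs @ [f])) fs \<turnstile> Ok)"
    using substitution_wf[OF ok yf] by (simp add: arg_context_subst step)
  then show ?case
    using Cons.IH[of "gs @ [f]" "App F (Var (y f))"] F Cons.prems(1) by (simp add: \<rho>_def)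
qed

text \<open>The split into \<Gamma> and \<Xi> reflects that the argument telescope of
  \<open>K\<close> is known to be well-formed only over the objects before \<open>K\<close>.
  Disjointness of names allows it to be weakened past \<Xi>, and \<open>fresh\<close> keeps the
  supplied variables from being captured by its binders.\<close>

lemma object_app_typing:
  assumes K: "K \<in> Obj \<L>" and ok: "wf_derivable (\<Gamma> @ \<Xi> \<turnstile> Ok)"
    and args: "wf_derivable (\<Gamma> @ arg_context ArrName (as K) \<turnstile> Ok)"
    and obj: "(ObjName K, object_type \<L> as K) \<in> set (\<Gamma> @ \<Xi>)"
    and disj: "vars \<Xi> \<inter> ArrName ` set (as K) = {}"
    and y: "\<And>f. f \<in> set (as K) \<Longrightarrow> wf_derivable (\<Gamma> @ \<Xi> \<turnstile> HasType (Var (y f)) (arg_type y f))"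
    and fresh: "\<And>f. f \<in> set (as K) \<Longrightarrow> y f \<notin> ArrName ` set (as K)"
  shows "wf_derivable (\<Gamma> @ \<Xi> \<turnstile> HasType (app (Var (ObjName K)) (map (\<lambda>f. Var (y f)) (as K))) TU)"
proof (cases "as K = []")
  case True
  then have F: "wf_derivable (\<Gamma> @ \<Xi> \<turnstile> HasType (Var (ObjName K)) (Fun_type TOne TU))"
    using var_in_context[OF ok obj] set_as[OF K] by (simp add: object_type_eq)
  obtain x where x: "x \<notin> vars (\<Gamma> @ \<Xi>)"
    using fresh_name[OF infinite_name, of "vars (\<Gamma> @ \<Xi>)"] by auto
  have "wf_derivable ((\<Gamma> @ \<Xi>) @ [(x, TOne)] \<turnstile> IsType TU)"
    by (intro U_form_wf extend_wf One_form_wf ok x)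
  from Pi_elim_wf[OF this _ One_intro_wf[OF ok]] F show ?thesis
    using True by (simp add: app_def)
next
  case False
  then have F: "wf_derivable (\<Gamma> @ \<Xi> \<turnstile> HasType (Var (ObjName K)) (pi_over ArrName (as K)))"
    using var_in_context[OF ok obj] set_as[OF K] by (simp add: object_type_eq split: if_splits)
  have "wf_derivable ((\<Gamma> @ \<Xi>) @ arg_context ArrName (as K) \<turnstile> Ok)"
    using weakening_context[OF args ok] disj by simp
  then show ?thesis
    using foldl_App_typing[OF K, of "[]" "as K", OF _ y fresh] F False by (simp add: app_def)
qed

text \<open>The type of \<open>f\<close> applies the earlier object \<open>Cod \<L> f\<close> to
  composites listed before \<open>f\<close>. Typing that application needs the telescope of
  \<open>Cod \<L> f\<close>, provided by \<open>prev\<close>.\<close>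

lemma arg_context_Ok:
  assumes os: "os = Ks @ K # Ks'" and ok: "wf_derivable (object_context Ks \<turnstile> Ok)"
    and prev: "\<And>Ks\<^sub>1 K' Ks\<^sub>2. Ks = Ks\<^sub>1 @ K' # Ks\<^sub>2 \<Longrightarrow>
      wf_derivable (object_context Ks\<^sub>1 @ arg_context ArrName (as K') \<turnstile> Ok)"
    and "as K = fs @ gs"
  shows "wf_derivable (object_context Ks @ arg_context ArrName fs \<turnstile> Ok)"
  using assms(4)
proof (induction fs arbitrary: gs rule: rev_induct)
  case Nil
  then show ?case using ok by simp
next
  case (snoc f fs)
  have K: "K \<in> Obj \<L>" using os set_os by auto
  have asK: "as K = fs @ f # gs" using snoc.prems by simp
  have f: "f \<in> arrows_from \<L> K" using asK set_as[OF K] by auto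
  let ?K' = "Cod \<L> f"
  let ?\<Theta> = "object_context Ks @ arg_context ArrName fs"
  have K': "?K' \<in> Obj \<L>" by (rule arrows_fromD[OF f])
  have "?K' \<in> set Ks" by (rule Cod_before[OF os f])
  then obtain Ks\<^sub>1 Ks\<^sub>2 where Ks: "Ks = Ks\<^sub>1 @ ?K' # Ks\<^sub>2" by (meson split_list)
  let ?\<Xi> = "object_context (?K' # Ks\<^sub>2) @ arg_context ArrName fs"
  have \<Theta>: "?\<Theta> = object_context Ks\<^sub>1 @ ?\<Xi>" using Ks by simp
  have ok': "wf_derivable (?\<Theta> \<turnstile> Ok)" using snoc.IH asK by blast
  \<comment> \<open>An arrow has one domain, so the argument names of \<open>K\<close> and of
    \<open>?K'\<close> cannot clash.\<close>
  have "?K' \<noteq> K" using Ks os distinct_os by auto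
  then have disjoint: "arrows_from \<L> K \<inter> arrows_from \<L> ?K' = {}"
    by (auto simp: arrows_from_def)
  have "wf_derivable (object_context Ks\<^sub>1 @ ?\<Xi> \<turnstile>
      HasType (app (Var (ObjName ?K')) (map (\<lambda>p. Var (ArrName (Cmp \<L> p f))) (as ?K'))) TU)"
  proof (rule object_app_typing[OF K' _ prev[OF Ks]])
    show "wf_derivable (object_context Ks\<^sub>1 @ ?\<Xi> \<turnstile> Ok)" using ok' \<Theta> by simp
    show "(ObjName ?K', object_type \<L> as ?K') \<in> set (object_context Ks\<^sub>1 @ ?\<Xi>)" by simp
    show "vars ?\<Xi> \<inter> ArrName ` set (as ?K') = {}"
      using disjoint set_as[OF K] set_as[OF K'] asK by auto
    fix p assume p: "p \<in> set (as ?K')"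
    then have p': "p \<in> arrows_from \<L> ?K'" using set_as[OF K'] by simp
    note c = Cmp_arrows_from[OF K f p']
    show "ArrName (Cmp \<L> p f) \<notin> ArrName ` set (as ?K')"
      using c disjoint set_as[OF K'] by auto
    \<comment> \<open>The declaration of the composite of \<open>p\<close> and \<open>f\<close>
      mentions the left side; the argument \<open>p\<close> of \<open>?K'\<close> is required to
      have a type mentioning the right side.\<close>
    have "Cmp \<L> q (Cmp \<L> p f) = Cmp \<L> (Cmp \<L> q p) f" if "q \<in> set (as (Cod \<L> p))" for q
    proof -
      have "q \<in> arrows_from \<L> (Cod \<L> p)" using that set_as arrows_fromD(3)[OF p'] by simp
      then show ?thesis
        using category arrows_fromD[OF f] arrows_fromD[OF p'] arrows_fromD[of q "Cod \<L> p"]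
        by (simp add: is_category_def)
    qed
    then have "arg_type (\<lambda>p. ArrName (Cmp \<L> p f)) p = arg_type ArrName (Cmp \<L> p f)"
      by (simp add: arg_type_def c(2) cong: map_cong)
    moreover have "(ArrName (Cmp \<L> p f), arg_type ArrName (Cmp \<L> p f)) \<in> set ?\<Theta>"
      using Cmp_before[OF K asK p] by (auto simp: arg_context_def)
    ultimately show "wf_derivable (object_context Ks\<^sub>1 @ ?\<Xi> \<turnstile>
        HasType (Var (ArrName (Cmp \<L> p f))) (arg_type (\<lambda>p. ArrName (Cmp \<L> p f)) p))"
      using var_in_context[OF ok'] \<Theta> by simp
  qed
  then have "wf_derivable (?\<Theta> \<turnstile> IsType (arg_type ArrName f))"
    unfolding \<Theta> arg_type_def by (rule El_form_wf)
  moreover have "ArrName f \<notin> vars ?\<Theta>"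
    using distinct_as[OF K] asK by auto
  ultimately show ?case using extend_wf by fastforce
qed

text \<open>The second conjunct strengthens the induction: the telescope of a new object depends on
  the telescopes of all earlier ones.\<close>

lemma object_context_Ok:
  assumes "os = Ks @ Ks'"
  shows "wf_derivable (object_context Ks \<turnstile> Ok) \<and>
    (\<forall>Ks\<^sub>1 K Ks\<^sub>2. Ks = Ks\<^sub>1 @ K # Ks\<^sub>2 \<longrightarrow>
       wf_derivable (object_context Ks\<^sub>1 @ arg_context ArrName (as K) \<turnstile> Ok))"
  using assms
proof (induction Ks arbitrary: Ks' rule: rev_induct)
  case Nil
  then show ?case by (simp add: empty_wf)
next
  case (snoc K Ks)
  have os: "os = Ks @ K # Ks'" using snoc.prems by simp
  note IH = snoc.IH[OF os]
  have args: "wf_derivable (object_context Ks @ arg_context ArrName (as K) \<turnstile> Ok)"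
    using arg_context_Ok[OF os, of "as K" "[]"] IH by simp
  have "wf_derivable (object_context Ks \<turnstile> IsType (object_type \<L> as K))"
    using pi_over_type[OF args] IH
    by (auto simp: object_type_eq intro!: Fun_type_form infinite_name One_form_wf U_form_wf)
  moreover have "ObjName K \<notin> vars (object_context Ks)"
    using os distinct_os by auto
  ultimately have "wf_derivable (object_context (Ks @ [K]) \<turnstile> Ok)"
    using extend_wf by fastforce
  moreover have "wf_derivable (object_context Ks\<^sub>1 @ arg_context ArrName (as K') \<turnstile> Ok)"
    if "Ks @ [K] = Ks\<^sub>1 @ K' # Ks\<^sub>2" for Ks\<^sub>1 K' Ks\<^sub>2
    using that IH args by (cases Ks\<^sub>2 rule: rev_cases) auto
  ultimately show ?case by blast
qed

text \<open>
  The second case never arises in a derivable judgment; it is chosen so that substituting the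
  projections for the object variables yields \<open>component\<close> everywhere.
\<close>

definition object_var :: "'o \<Rightarrow> ('o, 'a) name expr" where
  "object_var K = (if K \<in> set os then Var (ObjName K) else component os (Var StrName) K)"

section \<open>Soundness of the logical rules over object variables\<close>

definition derivable_over :: "'o ljudgment \<Rightarrow> bool" where
  "derivable_over \<S> = (case \<S> of \<Gamma> \<turnstile>\<^sub>L J \<Rightarrow>
     wf_derivable (object_context os @ context_over object_var \<Gamma> \<turnstile> statement_over object_var J))"

lemma derivable_over_iff [simp]:
  "derivable_over (\<Gamma> \<turnstile>\<^sub>L J) \<longleftrightarrow>
     wf_derivable (object_context os @ context_over object_var \<Gamma> \<turnstile> statement_over object_var J)"
  by (simp add: derivable_over_def)

text \<open>The logical weakening rules only assume that the enlarged context is ok. Freshness and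
  well-formedness of the inserted sort, which \<open>weakening\<close> demands, are recovered from
  that context.\<close>

lemma derivable_over_weaken:
  assumes "wf_derivable (object_context os @ context_over object_var (\<Gamma> @ \<Delta>) \<turnstile> J)"
    and "wf_derivable (object_context os @ context_over object_var (\<Gamma> @ [(x, S)] @ \<Delta>) \<turnstile> Ok)"
  shows "wf_derivable (object_context os @ context_over object_var (\<Gamma> @ [(x, S)] @ \<Delta>) \<turnstile> J)"
proof -
  let ?\<Gamma> = "object_context os @ context_over object_var \<Gamma>"
  have ok: "wf_derivable (?\<Gamma> @ [(LogName x, sort_over object_var S)] @ context_over object_var \<Delta> \<turnstile> Ok)"
    using assms(2) by simp
  have "LogName x \<notin> vars (context_over object_var \<Delta>)"
    by (rule derivable_context_distinct[OF ok[unfolded append_Cons append_Nil]])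
  then show ?thesis
    using weakening_context[of ?\<Gamma> "context_over object_var \<Delta>" J "[(LogName x, sort_over object_var S)]"]
      assms(1) derivable_prefix_Ok[of "?\<Gamma> @ [(LogName x, sort_over object_var S)]"] ok by simp
qed

text \<open>Covers both sort rules, with \<open>ok\<close> as a separate premise because an object
  without outgoing non-identity arrows has no arguments to read it from. The object list is split at
  \<open>K\<close> to meet the form of \<open>object_app_typing\<close>.\<close>

lemma derivable_over_sort:
  assumes K: "K \<in> Obj \<L>"
    and ok: "wf_derivable (object_context os @ context_over object_var \<Gamma> \<turnstile> Ok)"
    and x: "\<And>f. f \<in> arrows_from \<L> K \<Longrightarrow> derivable_over
      (\<Gamma> \<turnstile>\<^sub>L LHasSort (x f) (Sort (Cod \<L> f) (map (\<lambda>p. x (Cmp \<L> p f)) (as (Cod \<L> f)))))"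
  shows "derivable_over (\<Gamma> \<turnstile>\<^sub>L LSort (Sort K (map x (as K))))"
proof -
  obtain Ks\<^sub>1 Ks\<^sub>2 where Ks: "os = Ks\<^sub>1 @ K # Ks\<^sub>2"
    using K set_os by (metis split_list)
  let ?\<Xi> = "object_context (K # Ks\<^sub>2) @ context_over object_var \<Gamma>"
  have \<Theta>: "object_context os @ context_over object_var \<Gamma> = object_context Ks\<^sub>1 @ ?\<Xi>"
    by (simp add: Ks)
  have "wf_derivable (object_context Ks\<^sub>1 @ ?\<Xi> \<turnstile>
      HasType (app (Var (ObjName K)) (map (\<lambda>f. Var (LogName (x f))) (as K))) TU)"
  proof (rule object_app_typing[OF K])
    show "wf_derivable (object_context Ks\<^sub>1 @ ?\<Xi> \<turnstile> Ok)" using ok \<Theta> by simp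
    show "wf_derivable (object_context Ks\<^sub>1 @ arg_context ArrName (as K) \<turnstile> Ok)"
      using object_context_Ok[of os "[]"] Ks by simp
    fix f assume "f \<in> set (as K)"
    then have f: "f \<in> arrows_from \<L> K" using set_as[OF K] by simp
    then show "wf_derivable (object_context Ks\<^sub>1 @ ?\<Xi> \<turnstile>
        HasType (Var (LogName (x f))) (arg_type (\<lambda>f. LogName (x f)) f))"
      using x[OF f] \<Theta> arrows_fromD(3)[OF f] set_os
      by (simp add: arg_type_def object_var_def comp_def)
  qed auto
  then show ?thesis
    using El_form_wf K set_os unfolding \<Theta>[symmetric] by (simp add: object_var_def comp_def)
qed

lemma ltt_derivable_over: "ltt_derivable \<L> as \<S> \<Longrightarrow> derivable_over \<S>"
proof (induction rule: ltt_derivable.induct)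
  case l_empty
  then show ?case using object_context_Ok[of os "[]"] by simp
next
  case (l_extend \<Gamma> S x)
  then show ?case
    using extend_wf[of "object_context os @ context_over object_var \<Gamma>" "sort_over object_var S" "LogName x"]
    by auto
next
  case (l_weaken_sort \<Gamma> \<Delta> S' x S)
  then show ?case using derivable_over_weaken by simp
next
  case (l_weaken_formula \<Gamma> \<Delta> \<phi> x S)
  then show ?case using derivable_over_weaken by simp
next
  case (l_var \<Gamma> x S \<Delta>)
  then show ?case by (auto intro: var_in_context)
next
  case (l_sort K \<Gamma> x)
  \<comment> \<open>Since there is some arrow out of \<open>K\<close>, there is a premise whose
    context can be inspected.\<close>
  then have "wf_derivable (object_context os @ context_over object_var \<Gamma> \<turnstile> Ok)"
    using derivable_Ok by fastforce
  then show ?case using derivable_over_sort l_sort by blast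
next
  case (l_sort_nullary K \<Gamma>)
  \<comment> \<open>The assignment is arbitrary: it is mapped over an empty list.\<close>
  then show ?case using derivable_over_sort[of K \<Gamma> "\<lambda>_. 0"] set_as[of K] by simp
next
  case (l_all \<Gamma> x S \<phi>)
  then show ?case
    using Pi_form_wf[of "object_context os @ context_over object_var \<Gamma>" "LogName x"] by simp
next
  case (l_ex \<Gamma> x S \<phi>)
  then show ?case
    using Sigma_form_wf[of "object_context os @ context_over object_var \<Gamma>" "LogName x"] by simp
qed (auto intro: Zero_form_wf One_form_wf Plus_form_wf Fun_type_form[OF infinite_name])

section \<open>From object variables to a structure\<close>

lemma Struc_eq_sigma_over: "struc_over \<L> as Ks = sigma_over (object_context Ks)"
  by (induction Ks rule: induct_list012) auto

lemma interp_derivable: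
  assumes "derivable_over \<S>"
  shows "mltt_derivable (interp \<L> os as \<S>)"
proof -
  obtain \<Gamma> J where \<S>: "\<S> = (\<Gamma> \<turnstile>\<^sub>L J)" by (cases \<S>)
  let ?M = "[(StrName, Struc \<L> os as)]"
  let ?\<theta> = "projections (map ObjName os) (Var StrName)"
  have M: "wf_derivable ([] \<turnstile> IsType (Struc \<L> os as))"
    using sigma_over_type[of "[]" "object_context os"] object_context_Ok[of os "[]"] by (simp add: Struc_eq_sigma_over)
  have ok: "wf_derivable (?M \<turnstile> Ok)"
    using extend_wf[OF M] by simp
  \<comment> \<open>The structure variable goes in front of the object variables, so that its
    projections are typed in the context \<open>?M\<close> preceding the variables they
    replace.\<close>
  have "wf_derivable (?M @ object_context os @ context_over object_var \<Gamma> \<turnstile> statement_over object_var J)"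
    using weakening_wf[of "[]" "object_context os @ context_over object_var \<Gamma>" _ "Struc \<L> os as" StrName]
      M assms \<S> by auto
  moreover have "wf_derivable (?M \<turnstile> HasType (Var StrName) (sigma_over (object_context os)))"
    using var_in_context[OF ok] by (simp add: Struc_eq_sigma_over)
  moreover have "map fst (object_context os) = map ObjName os"
    by (simp add: object_context_def)
  ultimately have "wf_derivable (?M @ subst_all_context (context_over object_var \<Gamma>) ?\<theta>
      \<turnstile> subst_all_statement (statement_over object_var J) ?\<theta>)"
    using substitution_projections[OF infinite_name] by fastforce
  moreover have "subst_all (object_var K) ?\<theta> = component os (Var StrName) K" for K
  proof (cases "K \<in> set os")
    case True
    then show ?thesis by (auto simp: object_var_def intro!: subst_all_projections distinct_os)
  next
    case False
    then show ?thesis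
      using projections_fv by (fastforce simp: object_var_def component_fv intro!: subst_all_fresh)
  qed
  moreover have fresh: "z \<noteq> LogName x \<and> LogName x \<notin> fv u" if "(z, u) \<in> set ?\<theta>" for z u x
    using projections_fv[OF that] by auto
  ultimately show ?thesis
    by (simp add: \<S> interp_eq_over over_subst_all[OF fresh] wf_derivable_def del: interp.simps)
qed

end

theorem theorem2p15:
  fixes \<L> :: "('o, 'a) signature" and os :: "'o list" and as :: "'o \<Rightarrow> 'a list"
    and \<S> :: "'o ljudgment"
  assumes "folds_signature \<L>" and "finite_signature \<L>"
    and "increasing_listing \<L> os as"
    and "ltt_derivable \<L> as \<S>"
  shows "mltt_derivable (interp \<L> os as \<S>)"
proof -
  interpret listed_signature \<L> os as
    using assms by unfold_locales
  show ?thesis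
    using interp_derivable ltt_derivable_over assms(4) by blast
qed

end
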